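(* Assume $a\ge 1$. Then $$(-1)^{n-1}F_a^{(n)}(x)>0\qquad\text{for all } x>1/a,\ n=1,2,\ldots.$$
   Context: For $a>0$ and real $x>1/a$, $F_a(x)=\dfrac{\ln\Gamma(x+1)}{x\ln(ax)}$, where $\Gamma$ is the Gamma function and $\ln$ the natural logarithm; $F_a^{(n)}$ denotes the $n$-th derivative. *)

theory Defs
  imports "HOL-Analysis.Analysis"
begin

(* Only the values at x > 1/a, where a * x > 1 and Gamma (x + 1) > 0, are meaningful. *)
definition F :: "real \<Rightarrow> real \<Rightarrow> real" where
  "F a x = ln (Gamma (x + 1)) / (x * ln (a * x))"

end

(*
  In the slit plane, f(z) = (ln_Gamma z + Ln z) / (z (Ln z + ln a)) is holomorphic except for a pole at
  1/a with residue ln (Gamma (1 + 1/a)) <= 0, and f extends F a.  Collapsing a contour around the cut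
  onto the negative axis writes f(z) as a constant plus that residue over z - 1/a minus the integral
  of d(t) / (z + t) over t > 0.  The density d(t) has the sign of
  ln |Gamma (1 - t)| + floor t * ln (a t), which is positive for a >= 1; differentiating gives the signs.

  To avoid growth estimates for ln_Gamma near the cut, the contour argument is applied to the partial
  Euler products N_K(z) = z ln (K+1) - sum_{k <= K} Ln (1 + z/k) in place of ln_Gamma z + Ln z.  In the
  coordinate w = Ln z the contour is a rectangle with right edge Re w = ln ((K+1)/2): up to there the
  density of N_K is already nonnegative, and the contribution of the vertical sides vanishes as K grows.
*)

theory Submission
  imports Defs "HOL-Complex_Analysis.Complex_Analysis" "HOL-Real_Asymp.Real_Asymp"
begin

section \<open>The density on the cut\<close>

text \<open>The kernel \<open>1 / (z - x) ^ Suc n\<close> sits in the integrand from the start, so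
  residues deliver the n-th derivative at \<open>x\<close> directly: no integral is differentiated,
  and the additive constant never appears. For n >= 1 the kernel also supplies the decay that kills
  the right edge, where N_K is only known to be O(K ln K). In logarithmic coordinates dz / z = dw
  absorbs the factor 1 / z, and a small arc about the branch point 0 becomes a straight left edge.

  The hypothesis a >= 1 enters twice: as 1/a <= 1, which fixes the sign of the residue, and as ln a
  >= 0, which lets the term with ln a be dropped from the density.

  A limit of strict inequalities need not be strict. Hence finite K is treated with a margin
  \<open>\<delta>\<close> that depends on a, x and n but not on K; it comes from the part 0 < t < 1
  of the cut. K runs through even numbers only: the radius (K + 1) / 2 is then a half-integer, at
  distance at least 1/2 from every logarithmic singularity -k.\<close>

lemma ln_sum_shift: "(\<Sum>i=1..n. ln (real (m + i))) = ln (fact (m + n)) - ln (fact m :: real)"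
proof (induction n)
  case (Suc n)
  have "ln (fact (m + Suc n) :: real) = ln (real (m + Suc n)) + ln (fact (m + n))"
    by (simp only: add_Suc_right fact_Suc of_nat_mult) (simp add: ln_mult del: of_nat_Suc)
  with Suc show ?case by simp
qed auto

lemma ln_sum_backward:
  "m \<le> K \<Longrightarrow> (\<Sum>k=1..m. ln (real K + 1 - real k)) = ln (fact K) - ln (fact (K - m) :: real)"
proof (induction m)
  case (Suc m)
  have "fact (K - m) = (real K - real m) * fact (K - Suc m)"
    using Suc.prems by (subst fact_reduce) (auto simp: of_nat_diff)
  hence "ln (fact (K - m) :: real) = ln (real K - real m) + ln (fact (K - Suc m))"
    using Suc.prems by (simp add: ln_mult)
  with Suc show ?case by simp
qed auto

text \<open>Both sides are compared with \<open>s / i\<close> through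
  \<open>ln (1 + y) \<le> y\<close>, used at \<open>y = 1 / i\<close> and at
  \<open>y = - s / i\<close>. This is the sign of a single factor of Euler's product at
  \<open>-s\<close>.\<close>

lemma mult_ln_one_plus_le:
  fixes s :: real
  assumes "0 \<le> s" "s < real i" "i \<ge> 1"
  shows "s * ln (1 + 1 / real i) \<le> - ln (1 - s / real i)"
proof -
  have "s * ln (1 + 1 / real i) \<le> s * (1 / real i)"
    using assms by (intro mult_left_mono ln_add_one_self_le_self) auto
  also have "ln (1 + (- (s / real i))) \<le> - (s / real i)"
    using assms by (intro ln_add_one_self_le_self2) (auto simp: field_simps)
  hence "s * (1 / real i) \<le> - ln (1 - s / real i)" by simp
  finally show ?thesis .
qed

text \<open>Telescoping. It spreads \<open>ln (K + 1)\<close> over the \<open>K\<close> factors, so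
  that estimates can be made factor by factor.\<close>

lemma sum_ln_one_plus: "(\<Sum>i=1..n. ln (1 + 1 / real i)) = ln (real n + 1)"
proof (induction n)
  case (Suc n)
  have "ln (1 + 1 / real (Suc n)) = ln ((real n + 2) / (real n + 1))"
    by (intro arg_cong[where f = ln]) (simp add: field_simps)
  also have "\<dots> = ln (real n + 2) - ln (real n + 1)"
    by (intro ln_divide_pos) auto
  finally show ?case using Suc by (simp add: add_ac)
qed auto

text \<open>
  Up to a positive factor this is the density on the cut of \<open>N_K z / (z (Ln z + \<alpha>))\<close>: the first two terms
  are the real part of \<open>N_K\<close> at \<open>-t\<close>, and the card counts the logarithms that contribute \<open>\<i> pi\<close> there.
  At the singularities \<open>t = k\<close> the value is junk, as \<open>ln 0 = 0\<close>.
\<close>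

definition cut_density :: "nat \<Rightarrow> real \<Rightarrow> real \<Rightarrow> real" where
  "cut_density K \<alpha> t = - t * ln (real K + 1) - (\<Sum>k=1..K. ln \<bar>1 - t / real k\<bar>)
     + real (card {k\<in>{1..K}. real k < t}) * (ln t + \<alpha>)"

text \<open>For \<open>t < 1\<close> the card is zero and every Euler factor contributes a
  nonnegative term, so the factor \<open>k = 1\<close> alone bounds the density, with
  \<open>- ln (1 - t) \<ge> t\<close>. The bound is free of \<open>K\<close> and
  \<open>\<alpha>\<close>; this keeps the final inequality strict.\<close>

lemma cut_density_ge:
  assumes "0 < t" "t < 1" "K \<ge> 1"
  shows "t * (1 - ln 2) \<le> cut_density K \<alpha> t"
proof -
  have *: "{k\<in>{1..K}. real k < t} = {}" using assms by auto
  have "cut_density K \<alpha> t = (\<Sum>k=1..K. - ln (1 - t / real k) - t * ln (1 + 1 / real k))"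
    unfolding cut_density_def * sum_subtractf sum_distrib_left[symmetric] sum_ln_one_plus
    using assms by (auto simp: sum_negf field_simps intro!: sum.cong)
  also have "\<dots> \<ge> (\<Sum>k\<in>{1::nat}. - ln (1 - t / real k) - t * ln (1 + 1 / real k))"
    using assms mult_ln_one_plus_le[of t] by (intro sum_mono2) auto
  finally have "- ln (1 - t) - t * ln 2 \<le> cut_density K \<alpha> t" by simp
  moreover have "ln (1 + (- t)) \<le> - t" using assms by (intro ln_add_one_self_le_self2) auto
  ultimately show ?thesis by (simp add: algebra_simps)
qed

text \<open>The product is split at \<open>m\<close>, the integer part of \<open>t\<close>. The
  factors below \<open>t\<close> produce \<open>m * ln t\<close>, which the card term cancels; those
  above are Euler factors at the fractional part, and their bounds telescope. What remains compares
  \<open>1 - k / t\<close> with \<open>1 - k / (K + 1)\<close> for \<open>k \<le> m\<close>, plus a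
  fractional remainder. The full strength of \<open>2 * t \<le> K + 1\<close> is spent on that
  remainder.\<close>

lemma cut_density_nonneg:
  assumes "0 < t" "2 * t \<le> real K + 1" "\<alpha> \<ge> 0" and nint: "\<And>k. k \<in> {1..K} \<Longrightarrow> real k \<noteq> t"
  shows "cut_density K \<alpha> t \<ge> 0"
proof (cases "K = 0")
  case True
  then show ?thesis by (simp add: cut_density_def)
next
  case False
  define m where "m = nat \<lfloor>t\<rfloor>"
  define s where "s = t - real m"
  have tK: "t \<le> real K" using False assms by linarith
  have mt: "real m \<le> t" "t < real m + 1" using assms unfolding m_def by linarith+
  have mK: "m \<le> K" using tK mt by linarith
  have "real m \<noteq> t" using nint[of m] mK assms(1) by (cases "m = 0") auto
  hence s: "0 < s" "s < 1" using mt by (auto simp: s_def)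
  have lt_iff: "real k < t \<longleftrightarrow> k \<le> m" for k :: nat
  proof
    assume "real k < t" then have "real k < real (Suc m)" using mt by simp
    then show "k \<le> m" by simp
  next
    assume "k \<le> m" then show "real k < t" using s unfolding s_def by linarith
  qed
  have set: "{k\<in>{1..K}. real k < t} = {1..m}" unfolding lt_iff using mK by auto
  have split: "{1..K} = {1..m} \<union> {m+1..K}" using mK by (intro set_eqI iffI) (auto simp: not_le)
  have "(\<Sum>k=1..K. ln \<bar>1 - t / real k\<bar>) =
        (\<Sum>k=1..m. ln \<bar>1 - t / real k\<bar>) + (\<Sum>k=m+1..K. ln \<bar>1 - t / real k\<bar>)"
    unfolding split by (intro sum.union_disjoint) auto
  also have "(\<Sum>k=1..m. ln \<bar>1 - t / real k\<bar>) = (\<Sum>k=1..m. ln t - ln (real k) + ln (1 - real k / t))"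
  proof (intro sum.cong refl)
    fix k assume k: "k \<in> {1..m}"
    hence kt: "real k < t" using lt_iff by auto
    have *: "1 < t / real k" "real k / t < 1" using k kt assms(1) by simp_all
    have "t / real k * (1 - real k / t) = t / real k - 1"
      using k assms(1) by (simp add: right_diff_distrib)
    hence "\<bar>1 - t / real k\<bar> = t / real k * (1 - real k / t)"
      using * by linarith
    also have "ln \<dots> = ln (t / real k) + ln (1 - real k / t)"
      using k * assms(1) by (intro ln_mult_pos) auto
    also have "ln (t / real k) = ln t - ln (real k)" using k assms(1) by (intro ln_divide_pos) auto
    finally show "ln \<bar>1 - t / real k\<bar> = ln t - ln (real k) + ln (1 - real k / t)" .
  qed
  also have "\<dots> = real m * ln t - ln (fact m) + (\<Sum>k=1..m. ln (1 - real k / t))"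
    using ln_sum_shift[of 0 m] by (simp add: sum.distrib sum_subtractf)
  also have "(\<Sum>k=m+1..K. ln \<bar>1 - t / real k\<bar>) = (\<Sum>i=1..K-m. ln \<bar>1 - t / real (m + i)\<bar>)"
    by (rule sum.reindex_bij_witness[of _ "\<lambda>i. m + i" "\<lambda>k. k - m"]) auto
  \<comment> \<open>With \<open>t = m + s\<close> each factor is \<open>i / (m + i)\<close> times
    \<open>1 - s / i\<close>: the first parts give factorials, and the bounds on the second
    telescope.\<close>
  also have "\<dots> \<le> (\<Sum>i=1..K-m. ln (real (0 + i)) - ln (real (m + i)) - s * ln (1 + 1 / real i))"
  proof (intro sum_mono)
    fix i assume i: "i \<in> {1..K-m}"
    have si: "s < real i" using i s by auto
    have *: "s / real i < 1" using i si by simp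
    have "1 - t / real (m + i) = (real i - s) / real (m + i)"
      using i by (simp add: s_def divide_simps)
    also have "\<dots> = real i / real (m + i) * (1 - s / real i)"
      using i by (simp add: right_diff_distrib diff_divide_distrib)
    finally have "\<bar>1 - t / real (m + i)\<bar> = real i / real (m + i) * (1 - s / real i)"
      using * by simp
    also have "ln \<dots> = ln (real i / real (m+i)) + ln (1 - s / real i)"
      using i * by (intro ln_mult_pos) auto
    also have "ln (real i / real (m+i)) = ln (real i) - ln (real (m+i))"
      using i by (intro ln_divide_pos) auto
    also have "ln (1 - s / real i) \<le> - (s * ln (1 + 1 / real i))"
      using mult_ln_one_plus_le[of s i] si i s by auto
    finally show "ln \<bar>1 - t / real (m + i)\<bar>
       \<le> ln (real (0 + i)) - ln (real (m + i)) - s * ln (1 + 1 / real i)" by simp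
  qed
  also have "\<dots> = ln (fact (K - m)) - (ln (fact K) - ln (fact m)) - s * ln (real (K - m) + 1)"
    unfolding sum_subtractf sum_distrib_left[symmetric] sum_ln_one_plus ln_sum_shift
    using mK by simp
  finally have 1: "(\<Sum>k=1..K. ln \<bar>1 - t / real k\<bar>) \<le> real m * ln t + (\<Sum>k=1..m. ln (1 - real k / t))
      + ln (fact (K - m)) - ln (fact K) - s * ln (real (K - m) + 1)"
    by simp
  \<comment> \<open>The contribution of \<open>\<alpha> \<ge> 0\<close> is dropped; the surviving
    \<open>real m * ln t\<close> cancels the one produced by the factors below
    \<open>t\<close>.\<close>
  have "cut_density K \<alpha> t \<ge> - t * ln (real K + 1) - (\<Sum>k=1..K. ln \<bar>1 - t / real k\<bar>) + real m * ln t"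
    unfolding cut_density_def set using assms by (simp add: algebra_simps)
  with 1 have 2: "cut_density K \<alpha> t \<ge> - t * ln (real K + 1) - (\<Sum>k=1..m. ln (1 - real k / t))
      - ln (fact (K - m)) + ln (fact K) + s * ln (real (K - m) + 1)"
    by simp
  \<comment> \<open>\<open>D k\<close> distributes the factorial quotient and \<open>m\<close>
    copies of \<open>ln (K + 1)\<close> over the indices, so that each can be paired with one
    \<open>ln (1 - k / t)\<close>.\<close>
  define D where "D k = ln (real K + 1 - real k) - ln (real K + 1)" for k :: nat
  have 3: "(\<Sum>k=1..m. D k) = ln (fact K) - ln (fact (K - m)) - real m * ln (real K + 1)"
    unfolding D_def sum_subtractf ln_sum_backward[OF mK] by simp
  have "s * ln (real (K - m) + 1) - s * ln (real K + 1) = s * D m"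
    using mK by (simp add: D_def of_nat_diff algebra_simps)
  hence 4: "cut_density K \<alpha> t \<ge> (\<Sum>k=1..m. D k - ln (1 - real k / t)) + s * D m"
    using 2 3 by (simp add: s_def algebra_simps sum_subtractf)
  have D_eq: "D k = ln (1 - real k / (real K + 1))" if "k \<le> m" for k
  proof -
    have "D k = ln ((real K + 1 - real k) / (real K + 1))"
      unfolding D_def using that mK by (intro ln_divide_pos[symmetric]) auto
    then show ?thesis by (simp add: diff_divide_distrib)
  qed
  have nonneg: "D k - ln (1 - real k / t) \<ge> 0" if "k \<in> {1..m}" for k
  proof -
    have "real k / (real K + 1) \<le> real k / t" using assms tK by (intro divide_left_mono) auto
    moreover have "real k / t < 1" using that lt_iff assms by auto
    ultimately have "ln (1 - real k / t) \<le> ln (1 - real k / (real K + 1))"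
      by (intro ln_mono) auto
    then show ?thesis using D_eq that by auto
  qed
  \<comment> \<open>The last term of the sum alone compensates the contribution \<open>s * D m\<close> of the fractional part.\<close>
  show ?thesis
  proof (cases "m = 0")
    case True
    then show ?thesis using 4 by (simp add: D_def)
  next
    case m0: False
    have "(\<Sum>k\<in>{m}. D k - ln (1 - real k / t)) \<le> (\<Sum>k=1..m. D k - ln (1 - real k / t))"
      using nonneg m0 by (intro sum_mono2) auto
    hence 5: "cut_density K \<alpha> t \<ge> D m - ln (1 - real m / t) + s * D m" using 4 by simp
    define y where "y = real m / (real K + 1)"
    have y: "0 \<le> y" "y < 1" using mK by (auto simp: y_def)
    have Dm: "D m = ln (1 - y)" using D_eq[of m] by (simp add: y_def)
    have "D m \<le> s * D m"
      using mult_right_mono_neg[of s 1 "D m"] s y Dm by simp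
    \<comment> \<open>Since \<open>2 * t \<le> K + 1\<close> gives \<open>m / t \<ge> 2 * y\<close>,
      and \<open>1 - 2 * y \<le> (1 - y) ^ 2\<close>, the square pays for \<open>D m\<close> twice:
      once for the last summand, once for the fractional part.\<close>
    moreover have "ln (1 - real m / t) \<le> ln ((1 - y) ^ 2)"
    proof (intro ln_mono)
      have "2 * y \<le> real m / t" 
      proof -
        have "2 * y = real m / ((real K + 1) / 2)" by (simp add: y_def)
        also have "\<dots> \<le> real m / t" using assms(1,2) by (intro divide_left_mono) auto
        finally show ?thesis .
      qed
      moreover have "1 - 2 * y \<le> (1 - y) ^ 2" by (simp add: power2_eq_square algebra_simps)
      ultimately show "1 - real m / t \<le> (1 - y)\<^sup>2" by simp
      show "0 < 1 - real m / t" using lt_iff[of m] assms by simp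
    qed
    moreover have "ln ((1 - y) ^ 2) = 2 * D m" using y Dm by (simp add: ln_realpow)
    ultimately show ?thesis using 5 by linarith
  qed
qed

text \<open>The finite version of \<open>Gamma (1 + y) \<le> 1\<close> on \<open>(0, 1]\<close>,
  meant for the residue at \<open>y = 1 / a\<close>. Each factor follows from concavity of
  \<open>ln\<close>, as \<open>1 + y / k\<close> is the mean of \<open>1\<close> and
  \<open>1 + 1 / k\<close> with weight \<open>y\<close> on the latter.\<close>

lemma euler_partial_nonpos:
  assumes "0 < y" "y \<le> (1::real)"
  shows "y * ln (real K + 1) - (\<Sum>k=1..K. ln (1 + y / real k)) \<le> 0"
proof -
  have "y * ln (1 + 1 / real k) \<le> ln (1 + y / real k)" if "k \<in> {1..K}" for k
    using concave_onD[OF ln_concave, of y 1 "1 + 1 / real k"] assms that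
    by (simp add: algebra_simps add_pos_pos)
  hence "(\<Sum>k=1..K. y * ln (1 + 1 / real k)) \<le> (\<Sum>k=1..K. ln (1 + y / real k))"
    by (rule sum_mono)
  hence "y * (\<Sum>k=1..K. ln (1 + 1 / real k)) \<le> (\<Sum>k=1..K. ln (1 + y / real k))"
    by (simp only: sum_distrib_left)
  then show ?thesis unfolding sum_ln_one_plus by simp
qed

section \<open>Contour integrals in logarithmic coordinates\<close>

lemma exp_strip_notin_nonpos_Reals:
  assumes "\<bar>Im w\<bar> < pi"
  shows "exp w \<notin> \<real>\<^sub>\<le>\<^sub>0"
proof
  assume "exp w \<in> \<real>\<^sub>\<le>\<^sub>0"
  moreover have "Ln (exp w) = w" using assms by (intro Ln_exp) auto
  ultimately have "Im w = pi" using Im_Ln_eq_pi[of "exp w"]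
    by (metis Im_Ln_eq_pi complex_nonpos_Reals_iff complex_eq_iff exp_not_eq_zero order_le_less zero_complex.sel)
  with assms show False by simp
qed

lemma rectpath_strip:
  assumes "0 < \<theta>" "\<theta> < pi" "A < B"
  shows "path_image (rectpath (Complex A (-\<theta>)) (Complex B \<theta>)) \<subseteq> {w. \<bar>Im w\<bar> < pi}"
proof -
  have "path_image (rectpath (Complex A (-\<theta>)) (Complex B \<theta>)) \<subseteq> cbox (Complex A (-\<theta>)) (Complex B \<theta>)"
    using assms by (intro path_image_rectpath_subset_cbox) auto
  also have "\<dots> \<subseteq> {w. \<bar>Im w\<bar> < pi}" using assms by (auto simp: in_cbox_complex_iff)
  finally show ?thesis .
qed

lemma rectpath_avoids_real:
  assumes "0 < \<theta>" "A < u" "u < B"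
  shows "complex_of_real u \<notin> path_image (rectpath (Complex A (-\<theta>)) (Complex B \<theta>))"
  using assms path_image_rectpath_inter_box[of "Complex A (-\<theta>)" "Complex B \<theta>"]
  by (auto simp: in_box_complex_iff)

lemma open_convex_strip: "open {w. \<bar>Im w\<bar> < c}" "convex {w. \<bar>Im w\<bar> < c}"
proof -
  have eq: "{w. \<bar>Im w\<bar> < c} = {w. Im w < c} \<inter> {w. Im w > -c}" by auto
  show "open {w. \<bar>Im w\<bar> < c}" unfolding eq by (intro open_Int open_halfspace_Im_lt open_halfspace_Im_gt)
  show "convex {w. \<bar>Im w\<bar> < c}" unfolding eq
    by (intro convex_Int convex_halfspace_Im_lt convex_halfspace_Im_gt)
qed

text \<open>On the strip \<open>exp\<close> is injective with inverse \<open>Ln\<close>, so each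
  singularity on the positive axis has just one preimage.\<close>

lemma exp_eq_of_real_strip:
  assumes "\<bar>Im w\<bar> < pi" "p > 0"
  shows "exp w = of_real p \<longleftrightarrow> w = of_real (ln p)"
proof
  assume "exp w = of_real p"
  moreover have "Ln (exp w) = w" using assms by (intro Ln_exp) auto
  ultimately show "w = of_real (ln p)" using assms by (simp add: Ln_of_real)
qed (use assms in \<open>simp add: exp_of_real\<close>)

lemma simply_connected_slit_plane: "simply_connected (- \<real>\<^sub>\<le>\<^sub>0 :: complex set)"
proof -
  have "\<real>\<^sub>\<le>\<^sub>0 = complex_of_real ` {..0}" by (auto simp: nonpos_Reals_def)
  then show ?thesis
    using starlike_slotted_complex_plane_left[of 0] by (simp add: starlike_imp_simply_connected)
qed

lemma deriv_exp_complex: "deriv exp = (exp :: complex \<Rightarrow> complex)"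
  by (intro ext DERIV_imp_deriv DERIV_exp)

text \<open>Pulling \<open>1 / (z - p)\<close> back along \<open>exp\<close> gives the logarithmic
  derivative of \<open>exp w - p\<close>, whose only pole in the strip is at \<open>ln p\<close>,
  with residue 1. So the winding number is that of the rectangle about \<open>ln p\<close>.\<close>

lemma winding_number_exp_rectpath:
  assumes "0 < \<theta>" "\<theta> < pi" "p > 0" "A < ln p" "ln p < B"
  shows "winding_number (exp \<circ> rectpath (Complex A (-\<theta>)) (Complex B \<theta>)) (complex_of_real p) = 1"
proof -
  define \<rho> where "\<rho> = rectpath (Complex A (-\<theta>)) (Complex B \<theta>)"
  define S where "S = {w. \<bar>Im w\<bar> < pi}"
  have \<rho>: "path_image \<rho> \<subseteq> S" "valid_path \<rho>" "pathfinish \<rho> = pathstart \<rho>"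
    unfolding \<rho>_def S_def using rectpath_strip[of \<theta> A B] assms by auto
  have notin: "complex_of_real (ln p) \<notin> path_image \<rho>"
    unfolding \<rho>_def using assms by (intro rectpath_avoids_real) auto
  have exp_eq: "exp w = of_real p \<longleftrightarrow> w = of_real (ln p)" if "w \<in> S" for w
    using that assms exp_eq_of_real_strip[of w p] unfolding S_def by auto
  have vp: "valid_path (exp \<circ> \<rho>)"
    using \<rho> by (intro valid_path_compose_analytic[where S=UNIV]) (auto intro: analytic_intros)
  have notin': "complex_of_real p \<notin> path_image (exp \<circ> \<rho>)"
    using notin exp_eq \<rho>(1) unfolding path_image_compose by force
  have "winding_number (exp \<circ> \<rho>) p = 1 / (2 * pi * \<i>) * contour_integral (exp \<circ> \<rho>) (\<lambda>w. 1 / (w - p))"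
    using winding_number_valid_path[OF vp notin'] .
  also have "contour_integral (exp \<circ> \<rho>) (\<lambda>w. 1 / (w - p))
      = contour_integral \<rho> (\<lambda>w. exp w * (1 / (exp w - p)))"
    by (subst deriv_exp_complex[symmetric], rule contour_integral_comp_analyticW[of _ UNIV]) (use \<rho> in \<open>auto intro: analytic_intros\<close>)
  also have "\<dots> = 2 * pi * \<i> * (\<Sum>q\<in>{complex_of_real (ln p)}. winding_number \<rho> q * residue (\<lambda>w. exp w * (1 / (exp w - p))) q)"
  proof (rule Residue_theorem)
    show "open S" "connected S" unfolding S_def by (auto intro: open_convex_strip convex_connected)
    show "(\<lambda>w. exp w * (1 / (exp w - p))) holomorphic_on S - {complex_of_real (ln p)}"
      using exp_eq by (intro holomorphic_intros) auto
    show "\<forall>z. z \<notin> S \<longrightarrow> winding_number \<rho> z = 0"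
      using \<rho> open_convex_strip(2)[of pi] unfolding S_def
      by (auto intro!: simply_connected_imp_winding_number_zero[of "{w. \<bar>Im w\<bar> < pi}"]
            convex_imp_simply_connected valid_path_imp_path)
  qed (use \<rho> notin in auto)
  finally have 1: "winding_number (exp \<circ> \<rho>) p = winding_number \<rho> (complex_of_real (ln p)) *
      residue (\<lambda>w. exp w * (1 / (exp w - p))) (complex_of_real (ln p))"
    by (simp del: o_apply)
  have "winding_number \<rho> (complex_of_real (ln p)) = 1"
    unfolding \<rho>_def using assms by (intro winding_number_rectpath) (auto simp: in_box_complex_iff)
  moreover have "residue (\<lambda>w. exp w * (1 / (exp w - p))) (complex_of_real (ln p)) = 1"
  proof (rule residue_simple')
    show "open S" "complex_of_real (ln p) \<in> S" unfolding S_def using open_convex_strip by auto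
    show "(\<lambda>w. exp w * (1 / (exp w - p))) holomorphic_on S - {complex_of_real (ln p)}"
      using exp_eq by (intro holomorphic_intros) auto
    have e: "exp (complex_of_real (ln p)) = p" using assms by (simp add: exp_of_real)
    have "(exp has_field_derivative exp (complex_of_real (ln p))) (at (complex_of_real (ln p)))"
      by (rule DERIV_exp)
    hence "((\<lambda>w. (exp w - p) / (w - complex_of_real (ln p))) \<longlongrightarrow> p) (at (complex_of_real (ln p)))"
      unfolding has_field_derivative_iff e .
    moreover have "((\<lambda>w. exp w :: complex) \<longlongrightarrow> p) (at (complex_of_real (ln p)))"
      using isCont_exp[of "complex_of_real (ln p)"] e unfolding isCont_def by metis
    ultimately have "((\<lambda>w. exp w / ((exp w - p) / (w - complex_of_real (ln p)))) \<longlongrightarrow> complex_of_real p / complex_of_real p) (at (complex_of_real (ln p)))"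
      using assms by (intro tendsto_divide) auto
    then show "((\<lambda>w. exp w * (1 / (exp w - p)) * (w - complex_of_real (ln p))) \<longlongrightarrow> 1) (at (complex_of_real (ln p)))"
      using assms by simp
  qed
  ultimately show ?thesis using 1 by (simp add: \<rho>_def)
qed

text \<open>Substituting \<open>z = exp w\<close> turns \<open>dz / z\<close> into
  \<open>dw\<close>, hence the denominator has no factor \<open>exp w\<close>. In the slit plane the
  integrand in \<open>z\<close> can have poles only at \<open>x\<close>, where the residue is a
  Taylor coefficient, and at \<open>exp (-\<alpha>)\<close>, where
  \<open>z * (Ln z + \<alpha>)\<close> has a zero with derivative 1, so that the residue is
  \<open>N\<close> times the kernel.\<close>

lemma contour_integral_exp_rectpath:
  fixes N :: "complex \<Rightarrow> complex" and \<alpha> x :: real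
  assumes N: "N holomorphic_on - \<real>\<^sub>\<le>\<^sub>0"
    and x: "exp (-\<alpha>) < x" and \<theta>: "0 < \<theta>" "\<theta> < pi" and AB: "A < -\<alpha>" "ln x < B"
  shows "contour_integral (rectpath (Complex A (-\<theta>)) (Complex B \<theta>))
           (\<lambda>w. N (exp w) / ((w + \<alpha>) * (exp w - x) ^ Suc n)) =
         2 * pi * \<i> * ((deriv ^^ n) (\<lambda>z. N z / (z * (Ln z + \<alpha>))) (complex_of_real x) / fact n
            + N (complex_of_real (exp (-\<alpha>))) / (complex_of_real (exp (-\<alpha>)) - complex_of_real x) ^ Suc n)"
proof -
  define p where "p = exp (-\<alpha>)"
  have p0: "p > 0" and px: "p < x" and lnp: "ln p = -\<alpha>" using x by (auto simp: p_def)
  have x0: "x > 0" using p0 px by simp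
  have lpx: "-\<alpha> < ln x" using p0 px lnp ln_less_cancel_iff[of p x] x0 by linarith
  define \<rho> where "\<rho> = rectpath (Complex A (-\<theta>)) (Complex B \<theta>)"
  define S where "S = {w. \<bar>Im w\<bar> < pi}"
  define f where "f = (\<lambda>z. N z / (z * (Ln z + \<alpha>)))"
  define g where "g = (\<lambda>z. f z / (z - x) ^ Suc n)"
  define C where "C = (- \<real>\<^sub>\<le>\<^sub>0 :: complex set)"
  have C_open: "open C" and C_sc: "simply_connected C"
    unfolding C_def using simply_connected_slit_plane
    by (auto intro!: open_Compl closed_nonpos_Reals_complex)
  have inC: "complex_of_real y \<in> C" if "y > 0" for y using that by (auto simp: C_def)
  have \<rho>: "path_image \<rho> \<subseteq> S" "valid_path \<rho>" "pathfinish \<rho> = pathstart \<rho>"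
    unfolding \<rho>_def S_def using rectpath_strip[of \<theta> A B] assms lpx by auto
  have vp: "valid_path (exp \<circ> \<rho>)"
    using \<rho> by (intro valid_path_compose_analytic[where S=UNIV]) (auto intro: analytic_intros)
  have ends: "complex_of_real (ln p) \<notin> path_image \<rho>" "complex_of_real (ln x) \<notin> path_image \<rho>"
    unfolding \<rho>_def lnp using \<theta> AB lpx by (intro rectpath_avoids_real; linarith)+
  have image: "path_image (exp \<circ> \<rho>) \<subseteq> C - {complex_of_real p, complex_of_real x}"
  proof -
    have "exp w \<in> C - {complex_of_real p, complex_of_real x}" if w: "w \<in> path_image \<rho>" for w
    proof -
      have Im: "\<bar>Im w\<bar> < pi" using w \<rho>(1) by (auto simp: S_def)
      have "exp w \<noteq> of_real p" unfolding exp_eq_of_real_strip[OF Im p0] by (intro notI) (use w ends in simp)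
      moreover have "exp w \<noteq> of_real x" unfolding exp_eq_of_real_strip[OF Im x0] by (intro notI) (use w ends in simp)
      moreover have "exp w \<in> C" unfolding C_def using exp_strip_notin_nonpos_Reals[OF Im] by simp
      ultimately show ?thesis by simp
    qed
    then show ?thesis unfolding path_image_compose by (rule image_subsetI)
  qed
  have Ln_zero: "Ln z + \<alpha> = 0 \<longleftrightarrow> z = of_real p" if "z \<in> C" for z
  proof -
    have "z \<noteq> 0" using that by (auto simp: C_def)
    have "z = of_real p" if "Ln z + \<alpha> = 0"
    proof -
      have "Ln z = complex_of_real (ln p)" using that lnp by (simp add: add_eq_0_iff2)
      hence "z = exp (complex_of_real (ln p))" using exp_Ln[OF \<open>z \<noteq> 0\<close>] by metis
      then show ?thesis using p0 by (simp add: exp_of_real)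
    qed
    moreover have "Ln (complex_of_real p) + \<alpha> = 0" using p0 lnp by (simp add: Ln_of_real)
    ultimately show ?thesis by blast
  qed
  have NC: "N holomorphic_on C" using N by (simp add: C_def)
  have f_holo: "f holomorphic_on C - {of_real p}"
    unfolding f_def using Ln_zero
    by (intro holomorphic_intros holomorphic_on_subset[OF NC]) (auto simp: C_def)
  have g_holo: "g holomorphic_on C - {complex_of_real p, complex_of_real x}"
    unfolding g_def by (intro holomorphic_intros holomorphic_on_subset[OF f_holo]) auto
  have "contour_integral \<rho> (\<lambda>w. N (exp w) / ((w + \<alpha>) * (exp w - x) ^ Suc n))
      = contour_integral \<rho> (\<lambda>w. exp w * g (exp w))"
  proof (rule contour_integral_cong)
    fix w assume "w \<in> path_image \<rho>"
    hence "\<bar>Im w\<bar> < pi" using \<rho>(1) by (auto simp: S_def)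
    hence "Ln (exp w) = w" by (intro Ln_exp) auto
    then show "N (exp w) / ((w + \<alpha>) * (exp w - x) ^ Suc n) = exp w * g (exp w)"
      by (simp add: g_def f_def)
  qed simp
  also have "\<dots> = contour_integral (exp \<circ> \<rho>) g"
    by (subst deriv_exp_complex[symmetric], rule contour_integral_comp_analyticW[of _ UNIV, symmetric]) (use \<rho> in \<open>auto intro: analytic_intros\<close>)
  also have "\<dots> = 2 * pi * \<i> * (\<Sum>q\<in>{complex_of_real p, complex_of_real x}. winding_number (exp \<circ> \<rho>) q * residue g q)"
  proof (rule Residue_theorem)
    show "\<forall>z. z \<notin> C \<longrightarrow> winding_number (exp \<circ> \<rho>) z = 0"
      using simply_connected_imp_winding_number_zero[OF C_sc valid_path_imp_path[OF vp]] image \<rho>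
      by (auto simp: pathstart_compose pathfinish_compose)
  qed (use C_open C_sc g_holo vp image \<rho> in \<open>auto simp: simply_connected_imp_connected pathstart_compose pathfinish_compose\<close>)
  also have "\<dots> = 2 * pi * \<i> * (residue g p + residue g x)"
    using winding_number_exp_rectpath[of \<theta> p A B] winding_number_exp_rectpath[of \<theta> x A B]
      p0 x0 px \<theta> AB lpx lnp unfolding \<rho>_def by (simp del: o_apply)
  also have "residue g p = N p / (complex_of_real p - complex_of_real x) ^ Suc n"
  proof (rule residue_simple')
    show "open (C - {complex_of_real x})" using C_open by (rule open_delete)
    show "complex_of_real p \<in> C - {complex_of_real x}" using inC[OF p0] px by simp
    show "g holomorphic_on C - {complex_of_real x} - {complex_of_real p}"
      by (rule holomorphic_on_subset[OF g_holo]) auto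
    have "(Ln has_field_derivative inverse (complex_of_real p)) (at (complex_of_real p))"
      using p0 by (intro has_field_derivative_Ln) auto
    hence "((\<lambda>z. (Ln z - Ln p) / (z - p)) \<longlongrightarrow> inverse (complex_of_real p)) (at (complex_of_real p))"
      unfolding has_field_derivative_iff .
    hence L: "((\<lambda>z. (Ln z + \<alpha>) / (z - p)) \<longlongrightarrow> inverse (complex_of_real p)) (at (complex_of_real p))"
      using p0 by (simp add: Ln_of_real lnp)
    have "continuous_on C N" by (rule holomorphic_on_imp_continuous_on[OF NC])
    hence Np: "(N \<longlongrightarrow> N p) (at (complex_of_real p))"
      using C_open inC[OF p0] unfolding continuous_on_eq_continuous_at[OF C_open] isCont_def by blast
    have "((\<lambda>z. N z / (z * ((Ln z + \<alpha>) / (z - p)) * (z - x) ^ Suc n)) \<longlongrightarrow>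
            N p / (complex_of_real p * inverse (complex_of_real p) * (complex_of_real p - complex_of_real x) ^ Suc n)) (at (complex_of_real p))"
      using p0 px by (intro tendsto_divide tendsto_mult tendsto_power tendsto_diff tendsto_ident_at tendsto_const L Np) simp_all
    moreover have "(\<lambda>z. N z / (z * ((Ln z + \<alpha>) / (z - p)) * (z - x) ^ Suc n)) = (\<lambda>z. g z * (z - p))"
      unfolding g_def f_def by (intro ext) simp
    ultimately show "((\<lambda>z. g z * (z - p)) \<longlongrightarrow> N p / (complex_of_real p - complex_of_real x) ^ Suc n) (at (complex_of_real p))"
      using p0 by simp
  qed
  also have "residue g x = (deriv ^^ n) f (complex_of_real x) / fact n"
    unfolding g_def
    by (rule residue_holomorphic_over_power[of "C - {complex_of_real p}"]) (use C_open inC[OF x0] px f_holo in auto)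
  finally show ?thesis unfolding \<rho>_def f_def p_def by (simp only: add.commute)
qed

lemma contour_integral_linepath_same_Im:
  assumes "A < B"
  shows "contour_integral (linepath (Complex A c) (Complex B c)) f = integral {A..B} (\<lambda>u. f (Complex u c))"
proof -
  have lp: "linepath (Complex A c) (Complex B c) t = linepath (of_real A) (of_real B) t + \<i> * c" for t
    by (simp add: linepath_def complex_eq_iff algebra_simps)
  have "Complex B c - Complex A c = of_real B - of_real A" by (simp add: complex_eq_iff)
  hence "contour_integral (linepath (Complex A c) (Complex B c)) f =
        contour_integral (linepath (of_real A) (of_real B)) (\<lambda>z. f (z + \<i> * c))"
    unfolding contour_integral_integral vector_derivative_linepath_at lp by simp
  also have "\<dots> = integral {A..B} (\<lambda>u. f (of_real u + \<i> * c))"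
    using assms by (subst contour_integral_linepath_Reals_eq) auto
  also have "(\<lambda>u. f (of_real u + \<i> * c)) = (\<lambda>u. f (Complex u c))"
    by (simp add: Complex_eq)
  finally show ?thesis .
qed

text \<open>By reflection the integral along the bottom edge is conjugate to the one along the top,
  which is traversed backwards, so the two add up to \<open>-2 * \<i>\<close> times an imaginary
  part. Each vertical edge is shorter than \<open>2 * pi\<close>, whence the error
  \<open>4 * pi * b\<close>.\<close>

lemma contour_integral_rectpath_symmetric:
  fixes H :: "complex \<Rightarrow> complex"
  assumes AB: "A < B" and \<theta>: "0 < \<theta>" "\<theta> < pi"
    and cont: "continuous_on (path_image (rectpath (Complex A (-\<theta>)) (Complex B \<theta>))) H"
    and sym: "\<And>u. u \<in> {A..B} \<Longrightarrow> H (Complex u (-\<theta>)) = cnj (H (Complex u \<theta>))"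
    and bnd: "\<And>u v. u \<in> {A, B} \<Longrightarrow> \<bar>v\<bar> \<le> \<theta> \<Longrightarrow> norm (H (Complex u v)) \<le> b"
  shows "norm (contour_integral (rectpath (Complex A (-\<theta>)) (Complex B \<theta>)) H
           + 2 * \<i> * of_real (integral {A..B} (\<lambda>u. Im (H (Complex u \<theta>))))) \<le> 4 * pi * b"
proof -
  define a1 a2 a3 a4 where "a1 = Complex A (-\<theta>)" and "a2 = Complex B (-\<theta>)"
    and "a3 = Complex B \<theta>" and "a4 = Complex A \<theta>"
  have rect: "rectpath (Complex A (-\<theta>)) (Complex B \<theta>) =
      linepath a1 a2 +++ linepath a2 a3 +++ linepath a3 a4 +++ linepath a4 a1"
    by (simp add: rectpath_def a1_def a2_def a3_def a4_def Let_def)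
  have pim: "path_image (rectpath (Complex A (-\<theta>)) (Complex B \<theta>)) =
      closed_segment a1 a2 \<union> closed_segment a2 a3 \<union> closed_segment a3 a4 \<union> closed_segment a4 a1"
    unfolding rect by (simp add: path_image_join Un_assoc)
  have int: "H contour_integrable_on linepath a1 a2" "H contour_integrable_on linepath a2 a3"
    "H contour_integrable_on linepath a3 a4" "H contour_integrable_on linepath a4 a1"
    by (intro contour_integrable_continuous_linepath continuous_on_subset[OF cont]; force simp: pim)+
  have seg: "closed_segment a1 a2 = {w. Re w \<in> {A..B} \<and> Im w = -\<theta>}"
     "closed_segment a4 a3 = {w. Re w \<in> {A..B} \<and> Im w = \<theta>}"
     "closed_segment a2 a3 = {w. Re w = B \<and> Im w \<in> {-\<theta>..\<theta>}}"
     "closed_segment a1 a4 = {w. Re w = A \<and> Im w \<in> {-\<theta>..\<theta>}}"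
    using AB \<theta> by (auto simp: a1_def a2_def a3_def a4_def closed_segment_same_Im closed_segment_same_Re
        closed_segment_eq_real_ivl)
  have b0: "b \<ge> 0" using bnd[of A 0] \<theta> norm_ge_zero order_trans by (metis abs_zero insertI1 less_imp_le)
  have side: "norm (contour_integral (linepath a2 a3) H) \<le> b * norm (a3 - a2)"
    "norm (contour_integral (linepath a4 a1) H) \<le> b * norm (a1 - a4)"
  proof -
    show "norm (contour_integral (linepath a2 a3) H) \<le> b * norm (a3 - a2)"
    proof (rule contour_integral_bound_linepath[OF int(2) b0])
      fix w assume "w \<in> closed_segment a2 a3"
      then show "norm (H w) \<le> b" using bnd[of "Re w" "Im w"] unfolding seg by (auto simp: abs_le_iff)
    qed
    show "norm (contour_integral (linepath a4 a1) H) \<le> b * norm (a1 - a4)"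
    proof (rule contour_integral_bound_linepath[OF int(4) b0])
      fix w assume "w \<in> closed_segment a4 a1"
      then show "norm (H w) \<le> b" using bnd[of "Re w" "Im w"]
        unfolding closed_segment_commute[of a4] seg by (auto simp: abs_le_iff)
    qed
  qed
  have contu: "continuous_on {A..B} (\<lambda>u. H (Complex u \<theta>))"
  proof (rule continuous_on_compose2[OF cont])
    show "continuous_on {A..B} (\<lambda>u. Complex u \<theta>)" unfolding Complex_eq by (intro continuous_intros)
    show "(\<lambda>u. Complex u \<theta>) ` {A..B} \<subseteq> path_image (rectpath (Complex A (- \<theta>)) (Complex B \<theta>))"
      unfolding pim closed_segment_commute[of a3] seg by auto
  qed
  hence i: "(\<lambda>u. H (Complex u \<theta>)) integrable_on {A..B}" by (rule integrable_continuous_real)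
  have bot: "contour_integral (linepath a1 a2) H = cnj (integral {A..B} (\<lambda>u. H (Complex u \<theta>)))"
  proof -
    have "contour_integral (linepath a1 a2) H = integral {A..B} (\<lambda>u. H (Complex u (-\<theta>)))"
      unfolding a1_def a2_def by (rule contour_integral_linepath_same_Im[OF AB])
    also have "\<dots> = integral {A..B} (\<lambda>u. cnj (H (Complex u \<theta>)))"
      by (intro integral_cong sym)
    finally show ?thesis by (simp add: integral_cnj)
  qed
  have top: "contour_integral (linepath a3 a4) H = - integral {A..B} (\<lambda>u. H (Complex u \<theta>))"
  proof -
    have "contour_integral (linepath a4 a3) H = integral {A..B} (\<lambda>u. H (Complex u \<theta>))"
      unfolding a4_def a3_def by (rule contour_integral_linepath_same_Im[OF AB])
    then show ?thesis
      using contour_integral_reversepath[of "linepath a4 a3" H] by simp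
  qed
  have im: "Im (integral {A..B} (\<lambda>u. H (Complex u \<theta>))) = integral {A..B} (\<lambda>u. Im (H (Complex u \<theta>)))"
    using integral_linear[OF i bounded_linear_Im] by (simp add: o_def)
  have "contour_integral (rectpath (Complex A (-\<theta>)) (Complex B \<theta>)) H =
      contour_integral (linepath a1 a2) H + contour_integral (linepath a2 a3) H
      + contour_integral (linepath a3 a4) H + contour_integral (linepath a4 a1) H"
    unfolding rect using int by (simp add: contour_integrable_joinI)
  also have "\<dots> = - 2 * \<i> * of_real (Im (integral {A..B} (\<lambda>u. H (Complex u \<theta>))))
      + contour_integral (linepath a2 a3) H + contour_integral (linepath a4 a1) H"
    unfolding bot top by (simp add: complex_eq_iff)
  finally have "contour_integral (rectpath (Complex A (-\<theta>)) (Complex B \<theta>)) H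
           + 2 * \<i> * of_real (integral {A..B} (\<lambda>u. Im (H (Complex u \<theta>)))) =
       contour_integral (linepath a2 a3) H + contour_integral (linepath a4 a1) H"
    unfolding im by simp
  also have "norm \<dots> \<le> b * norm (a3 - a2) + b * norm (a1 - a4)"
    by (intro norm_triangle_mono side)
  also have "\<dots> = b * (2 * \<theta>) + b * (2 * \<theta>)"
    using \<theta> by (simp add: a1_def a2_def a3_def a4_def cmod_def real_sqrt_mult)
  also have "\<dots> \<le> 4 * pi * b"
    using mult_left_mono[OF less_imp_le[OF \<theta>(2)] b0] by (simp add: algebra_simps)
  finally show ?thesis .
qed

section \<open>Collapsing the contour onto the cut\<close>

text \<open>A logarithm of the partial product of \<open>(1 + 1 / k) ^ z / (1 + z / k)\<close>,
  which tends to \<open>Gamma (1 + z)\<close>. With \<open>K + 1\<close> in place of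
  \<open>K\<close> the first term telescopes exactly into these factors. One \<open>Ln\<close> per
  factor makes the sum holomorphic on the whole slit plane.\<close>

definition euler_log :: "nat \<Rightarrow> complex \<Rightarrow> complex" where
  "euler_log K z = z * of_real (ln (real K + 1)) - (\<Sum>k=1..K. Ln (1 + z / of_nat k))"

lemma exp_Complex: "exp (Complex u \<theta>) = of_real (exp u) * cis \<theta>"
  by (simp add: exp_eq_polar)

lemma Im_one_plus_exp_pos:
  assumes "0 < \<theta>" "\<theta> < pi" "k \<ge> 1"
  shows "Im (1 + exp (Complex u \<theta>) / of_nat k) > 0"
  using assms by (simp add: exp_Complex Im_divide_of_nat sin_gt_zero)

text \<open>The cut is approached from above. Where \<open>1 - exp u / k\<close> is negative, the
  limit lies on the branch cut of \<open>Ln\<close> itself, and the approach through the upper half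
  plane selects the argument \<open>pi\<close>.\<close>

lemma tendsto_Ln_one_plus_exp:
  assumes \<theta>: "\<theta> \<longlonglongrightarrow> pi" "\<And>i. 0 < \<theta> i" "\<And>i. \<theta> i < pi" and k: "k \<ge> 1" "exp u \<noteq> real k"
  shows "(\<lambda>i. Ln (1 + exp (Complex u (\<theta> i)) / of_nat k)) \<longlonglongrightarrow>
           Complex (ln \<bar>1 - exp u / real k\<bar>) (if real k < exp u then pi else 0)"
proof -
  define v where "v = (\<lambda>i. 1 + exp (Complex u (\<theta> i)) / of_nat k)"
  define r where "r = 1 - exp u / real k"
  have r0: "r \<noteq> 0" using k by (simp add: r_def)
  have rk: "r < 0 \<longleftrightarrow> real k < exp u" using k by (simp add: r_def)
  have "v \<longlonglongrightarrow> 1 + of_real (exp u) * cis pi / of_nat k"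
    unfolding v_def exp_Complex using k by (intro tendsto_add tendsto_divide tendsto_mult tendsto_const tendsto_cis \<theta>(1)) simp
  also have "1 + of_real (exp u) * cis pi / of_nat k = complex_of_real r"
    by (simp add: r_def)
  finally have v: "v \<longlonglongrightarrow> complex_of_real r" .
  have Im: "Im (v i) > 0" for i unfolding v_def by (rule Im_one_plus_exp_pos[OF \<theta>(2,3) k(1)])
  show ?thesis
  proof (cases "r > 0")
    case True
    have "(\<lambda>i. Ln (v i)) \<longlonglongrightarrow> Ln (complex_of_real r)"
      using v True by (intro tendsto_Ln) auto
    also have "Ln (complex_of_real r) = Complex (ln \<bar>r\<bar>) (if real k < exp u then pi else 0)"
      using True rk by (simp add: Ln_of_real complex_eq_iff)
    finally show ?thesis by (simp add: v_def r_def)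
  next
    case False
    hence r: "r < 0" using r0 by simp
    \<comment> \<open>\<open>Ln\<close> is discontinuous at the negative limit. After negation the
      limit is positive, and \<open>Im (v i) > 0\<close> fixes the shift as
      \<open>+ \<i> * pi\<close>.\<close>
    have "(\<lambda>i. Ln (- v i) + \<i> * pi) \<longlonglongrightarrow> Ln (- complex_of_real r) + \<i> * pi"
      using v r by (intro tendsto_intros tendsto_Ln) auto
    moreover have "Ln (- v i) + \<i> * pi = Ln (v i)" for i
    proof -
      have "v i \<noteq> 0" using Im[of i] by auto
      then show ?thesis using Ln_minus[of "v i"] Im[of i] by simp
    qed
    moreover have "Ln (- complex_of_real r) + \<i> * pi = Complex (ln \<bar>r\<bar>) (if real k < exp u then pi else 0)"
      using r rk Ln_of_real[of "-r"] by (simp add: complex_eq_iff)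
    ultimately show ?thesis by (simp add: v_def r_def)
  qed
qed

section \<open>An integrable majorant, uniform in the height of the contour\<close>

lemma norm_Ln_le_abs_ln:
  assumes "v \<noteq> 0"
  shows "norm (Ln v) \<le> \<bar>ln (norm v)\<bar> + pi"
proof -
  have "norm (Ln v) \<le> \<bar>Re (Ln v)\<bar> + \<bar>Im (Ln v)\<bar>" by (rule cmod_le)
  moreover have "\<bar>Im (Ln v)\<bar> \<le> pi"
    using Im_Ln_le_pi[OF assms] mpi_less_Im_Ln[OF assms] by (simp add: abs_le_iff)
  ultimately show ?thesis using assms by simp
qed

text \<open>Trades a logarithmic singularity for an inverse square root, which has an elementary
  antiderivative. For small \<open>r\<close> the estimate \<open>ln y \<le> y - 1\<close> is taken
  at \<open>y = 1 / sqrt r\<close>.\<close>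

lemma abs_ln_le:
  assumes "(r::real) > 0"
  shows "\<bar>ln r\<bar> \<le> r + 2 / sqrt r"
proof -
  have "ln r \<le> r - 1" using assms by (rule ln_le_minus_one)
  moreover have "ln (1 / sqrt r) \<le> 1 / sqrt r - 1" using assms by (intro ln_le_minus_one) auto
  moreover have "ln (1 / sqrt r) = - (ln r / 2)" using assms by (simp add: ln_div ln_sqrt)
  moreover have "1 / sqrt r > 0" using assms by simp
  moreover have "2 / sqrt r = 2 * (1 / sqrt r)" by simp
  ultimately show ?thesis using assms by linarith
qed

lemma abs_one_minus_exp_ge: "\<bar>1 - exp s\<bar> \<ge> \<bar>s\<bar> * min 1 (exp s)" for s :: real
proof (cases "s \<ge> 0")
  case True
  hence "min 1 (exp s) = 1" "\<bar>1 - exp s\<bar> = exp s - 1" by auto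
  then show ?thesis using exp_ge_add_one_self[of s] True by linarith
next
  case False
  have "(- s) * exp s \<le> (exp (- s) - 1) * exp s"
    using exp_ge_add_one_self[of "-s"] by (intro mult_right_mono) auto
  also have "\<dots> = 1 - exp s" by (simp add: left_diff_distrib exp_minus)
  finally show ?thesis using False by (simp add: min_def)
qed

text \<open>With \<open>s = u - ln k\<close>, the modulus of
  \<open>exp (Complex u \<theta>) / k\<close> is \<open>exp s\<close> whatever
  \<open>\<theta>\<close> is, so the argument of \<open>Ln\<close> has modulus at least
  \<open>\<bar>1 - exp s\<bar>\<close>, hence at least a constant times
  \<open>\<bar>s\<bar>\<close>. The bound is free of \<open>\<theta>\<close>, as domination
  requires.\<close>

lemma norm_Ln_one_plus_exp_le:
  assumes k: "k \<ge> 1" and u: "u \<in> {A..B}" "u \<noteq> ln (real k)" 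
    and v: "1 + exp (Complex u \<theta>) / of_nat k \<noteq> 0"
  shows "norm (Ln (1 + exp (Complex u \<theta>) / of_nat k))
     \<le> (1 + exp B + pi) + 2 / sqrt (min 1 (exp (A - ln (real k)))) * (1 / sqrt \<bar>u - ln (real k)\<bar>)"
proof -
  define r where "r = norm (1 + exp (Complex u \<theta>) / of_nat k)"
  define s where "s = u - ln (real k)"
  have r0: "r > 0" using v by (simp add: r_def)
  have nz: "norm (exp (Complex u \<theta>) / of_nat k) = exp s"
    using k by (simp add: norm_divide s_def exp_diff)
  have "r \<le> 1 + exp s" unfolding r_def nz[symmetric] using norm_triangle_ineq[of 1 "exp (Complex u \<theta>) / of_nat k"] by simp
  moreover have "ln (real k) \<ge> 0" using k by simp
  hence "exp s \<le> exp B" using u by (simp add: s_def)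
  ultimately have r_le: "r \<le> 1 + exp B" by linarith
  define \<mu> where "\<mu> = min 1 (exp (A - ln (real k)))"
  have \<mu>: "\<mu> > 0" by (simp add: \<mu>_def)
  have "\<mu> * \<bar>s\<bar> \<le> min 1 (exp s) * \<bar>s\<bar>"
    unfolding \<mu>_def using u by (intro mult_right_mono min.mono) (auto simp: s_def)
  also have "\<dots> \<le> \<bar>1 - exp s\<bar>" using abs_one_minus_exp_ge[of s] by (simp add: mult.commute)
  also have "\<dots> \<le> r" unfolding r_def nz[symmetric]
    using norm_triangle_ineq3[of 1 "- (exp (Complex u \<theta>) / of_nat k)"] by simp
  finally have r_ge: "\<mu> * \<bar>s\<bar> \<le> r" .
  have s0: "s \<noteq> 0" using u by (simp add: s_def)
  have "norm (Ln (1 + exp (Complex u \<theta>) / of_nat k)) \<le> \<bar>ln r\<bar> + pi"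
    using norm_Ln_le_abs_ln[OF v] by (simp add: r_def)
  also have "\<bar>ln r\<bar> \<le> r + 2 / sqrt r" by (rule abs_ln_le[OF r0])
  also have "2 / sqrt r \<le> 2 / sqrt (\<mu> * \<bar>s\<bar>)"
    using r_ge \<mu> s0 r0 by (intro divide_left_mono) (auto intro!: mult_pos_pos)
  also have "\<dots> = 2 / sqrt \<mu> * (1 / sqrt \<bar>s\<bar>)" by (simp add: real_sqrt_mult)
  finally show ?thesis using r_le by (simp add: \<mu>_def s_def)
qed

lemma integrable_on_inverse_sqrt_abs:
  fixes A B c :: real
  assumes "A \<le> B"
  shows "(\<lambda>u. 1 / sqrt \<bar>u - c\<bar>) integrable_on {A..B}"
proof -
  have "((\<lambda>u. 1 / sqrt \<bar>u - c\<bar>) has_integral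
      (2 * sgn (B - c) * sqrt \<bar>B - c\<bar> - 2 * sgn (A - c) * sqrt \<bar>A - c\<bar>)) {A..B}"
  proof (rule fundamental_theorem_of_calculus_strong[of "{c}"])
    \<comment> \<open>Written with \<open>max\<close>, the antiderivative is visibly continuous at
      \<open>c\<close>, the one point where it is not differentiable.\<close>
    have eq: "(\<lambda>u. 2 * sgn (u - c) * sqrt \<bar>u - c\<bar>) = (\<lambda>u. 2 * (sqrt (max 0 (u - c)) - sqrt (max 0 (c - u))))"
      by (auto simp: fun_eq_iff sgn_if max_def)
    show "continuous_on {A..B} (\<lambda>u. 2 * sgn (u - c) * sqrt \<bar>u - c\<bar>)"
      unfolding eq by (intro continuous_intros)
    fix u assume u: "u \<in> {A..B} - {c}"
    show "((\<lambda>u. 2 * sgn (u - c) * sqrt \<bar>u - c\<bar>) has_vector_derivative 1 / sqrt \<bar>u - c\<bar>) (at u)"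
    proof (cases "u > c")
      case True
      have "((\<lambda>u. 2 * sqrt (u - c)) has_real_derivative 1 / sqrt \<bar>u - c\<bar>) (at u)"
        using True by (auto intro!: derivative_eq_intros simp: field_simps)
      then show ?thesis unfolding has_real_derivative_iff_has_vector_derivative
        by (rule has_vector_derivative_transform_within_open[of _ _ _ "{c<..}"]) (use True in auto)
    next
      case False
      have "((\<lambda>u. - 2 * sqrt (c - u)) has_real_derivative 1 / sqrt \<bar>u - c\<bar>) (at u)"
        using False u by (auto intro!: derivative_eq_intros simp: field_simps)
      then show ?thesis unfolding has_real_derivative_iff_has_vector_derivative
        by (rule has_vector_derivative_transform_within_open[of _ _ _ "{..<c}"]) (use False u in auto)
    qed
  qed (use assms in auto)
  then show ?thesis by (rule has_integral_integrable)
qed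

text \<open>From the angle \<open>pi / 2\<close> on, \<open>exp w\<close> lies in the closed left
  half plane, so its distance from \<open>x\<close> is at least \<open>x\<close>.\<close>

lemma norm_exp_minus_ge:
  assumes "pi / 2 \<le> \<theta>" "\<theta> \<le> pi" "x > 0"
  shows "norm (exp (Complex u \<theta>) - complex_of_real x) \<ge> x"
proof -
  have "cos \<theta> \<le> cos (pi / 2)" using assms by (intro cos_monotone_0_pi_le) auto
  hence "exp u * cos \<theta> \<le> 0" by (simp add: mult_le_0_iff cos_pi_half)
  hence "x \<le> - Re (exp (Complex u \<theta>) - complex_of_real x)" by (simp add: exp_Complex)
  also have "\<dots> \<le> norm (exp (Complex u \<theta>) - complex_of_real x)"
    using abs_Re_le_cmod[of "exp (Complex u \<theta>) - complex_of_real x"] by linarith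
  finally show ?thesis .
qed

text \<open>Here \<open>R - \<i> * pi * m\<close> stands for the boundary value of N_K and
  \<open>\<beta> + \<i> * pi\<close> for that of \<open>w + \<alpha>\<close>. Their quotient has
  imaginary part \<open>- pi * (R + m * \<beta>) / (\<beta>^2 + pi^2)\<close>, the origin of the
  combination in \<open>cut_density\<close>.\<close>

lemma Im_cut_limit:
  fixes R m \<beta> t x :: real
  assumes "t + x > 0"
  shows "Im (Complex R (- pi * m) / (Complex \<beta> pi * complex_of_real (- t - x) ^ Suc n)) =
     (- 1) ^ n * pi * ((R + m * \<beta>) / ((\<beta>\<^sup>2 + pi\<^sup>2) * (t + x) ^ Suc n))"
proof -
  have "- t - x = (- 1) * (t + x)" by simp
  hence "complex_of_real (- t - x) ^ Suc n = complex_of_real ((- 1) ^ Suc n * (t + x) ^ Suc n)"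
    by (simp only: of_real_power[symmetric] power_mult_distrib)
  hence "Im (Complex R (- pi * m) / (Complex \<beta> pi * complex_of_real (- t - x) ^ Suc n)) =
      Im (Complex R (- pi * m) / Complex \<beta> pi) / ((- 1) ^ Suc n * (t + x) ^ Suc n)"
    by (simp only: divide_divide_eq_left[symmetric] Im_divide_of_real)
  also have "Im (Complex R (- pi * m) / Complex \<beta> pi) = - pi * (R + m * \<beta>) / (\<beta>\<^sup>2 + pi\<^sup>2)"
    by (simp add: Im_divide algebra_simps)
  also have "- pi * (R + m * \<beta>) / (\<beta>\<^sup>2 + pi\<^sup>2) / ((- 1) ^ Suc n * (t + x) ^ Suc n) =
     (- 1) ^ n * pi * ((R + m * \<beta>) / ((\<beta>\<^sup>2 + pi\<^sup>2) * (t + x) ^ Suc n))"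
    by (cases "even n") (simp_all add: mult.assoc)
  finally show ?thesis .
qed

text \<open>Dominated convergence as the horizontal edge reaches the cut. The points
  \<open>ln k\<close> are taken out of \<open>S\<close> because no pointwise limit is available
  there; being finitely many, they do not change the integrals.\<close>

lemma tendsto_integral_cut:
  fixes \<alpha> x A B :: real and n K :: nat
  assumes AB: "A < B" and x: "x > 0"
    and \<theta>: "\<theta> \<longlonglongrightarrow> pi" "\<And>i. pi / 2 \<le> \<theta> i" "\<And>i. \<theta> i < pi"
  defines "q \<equiv> \<lambda>u. cut_density K \<alpha> (exp u) / (((u + \<alpha>)\<^sup>2 + pi\<^sup>2) * (exp u + x) ^ Suc n)"
    and "H \<equiv> \<lambda>w. euler_log K (exp w) / ((w + complex_of_real \<alpha>) * (exp w - complex_of_real x) ^ Suc n)"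
    and "S \<equiv> {A..B} - (\<lambda>k. ln (real k)) ` {1..K}"
  shows "q integrable_on S"
    and "(\<lambda>i. integral {A..B} (\<lambda>u. Im (H (Complex u (\<theta> i))))) \<longlonglongrightarrow> (- 1) ^ n * pi * integral S q"
proof -
  \<comment> \<open>The bound \<open>1 \<le> \<theta> i\<close> keeps \<open>w + \<alpha>\<close>
    away from 0 by its imaginary part alone, even where \<open>u = - \<alpha>\<close>.\<close>
  have \<theta>0: "0 < \<theta> i" "1 \<le> \<theta> i" for i using \<theta>(2)[of i] pi_gt3 by linarith+
  define g where "g = (\<lambda>k u. (1 + exp B + pi) +
      2 / sqrt (min 1 (exp (A - ln (real k)))) * (1 / sqrt \<bar>u - ln (real k)\<bar>))"
  define h where "h = (\<lambda>u. (exp B * ln (real K + 1) + (\<Sum>k=1..K. g k u)) / x ^ Suc n)"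
  have fin: "finite ((\<lambda>k. ln (real k)) ` {1..K})" by simp
  have nonint: "exp u \<noteq> real k" if "u \<in> S" "k \<in> {1..K}" for u k
  proof
    assume "exp u = real k"
    hence "u = ln (real k)" by (metis ln_exp)
    with that show False unfolding S_def by blast
  qed
  have spike: "(f integrable_on S) = (f integrable_on {A..B})" "integral S f = integral {A..B} f"
    for f :: "real \<Rightarrow> real"
    unfolding S_def using fin
    by (auto intro!: integrable_spike_set_eq integral_spike_set negligible_subset[OF negligible_finite[OF fin]])
  have nz: "1 + exp (Complex u (\<theta> i)) / of_nat k \<noteq> 0" if "k \<in> {1..K}" for u i k
  proof -
    have "Im (1 + exp (Complex u (\<theta> i)) / of_nat k) > 0"
      using that by (intro Im_one_plus_exp_pos \<theta>0 \<theta>) auto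
    then show ?thesis by (metis less_irrefl zero_complex.sel(2))
  qed
  have Im_nonneg: "1 + exp (Complex u (\<theta> i)) / of_nat k \<notin> \<real>\<^sub>\<le>\<^sub>0" if "k \<in> {1..K}" for u i k
  proof -
    have "Im (1 + exp (Complex u (\<theta> i)) / of_nat k) > 0"
      using that by (intro Im_one_plus_exp_pos \<theta>0 \<theta>) auto
    then show ?thesis by (metis less_irrefl complex_nonpos_Reals_iff)
  qed
  have w_ge: "norm (Complex u (\<theta> i) + complex_of_real \<alpha>) \<ge> 1" for u i
    using abs_Im_le_cmod[of "Complex u (\<theta> i) + complex_of_real \<alpha>"] \<theta>0(2)[of i] by simp
  have e_ge: "norm (exp (Complex u (\<theta> i)) - complex_of_real x) \<ge> x" for u i
    using \<theta>(2,3)[of i] x by (intro norm_exp_minus_ge) auto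
  have g_int: "g k integrable_on {A..B}" for k
    unfolding g_def using AB
    by (intro integrable_add integrable_on_mult_right integrable_on_inverse_sqrt_abs) auto
  have h_int: "h integrable_on S"
    unfolding spike h_def by (intro integrable_on_divide integrable_add integrable_sum g_int) auto
  have cont: "continuous_on {A..B} (\<lambda>u. Im (H (Complex u (\<theta> i))))" for i
  proof -
    have "Complex u (\<theta> i) + complex_of_real \<alpha> \<noteq> 0" "exp (Complex u (\<theta> i)) - complex_of_real x \<noteq> 0" for u
      using w_ge[of u i] e_ge[of u i] x by fastforce+
    then show ?thesis unfolding H_def euler_log_def Complex_eq
      using Im_nonneg[of _ _ i] unfolding Complex_eq
      by (intro continuous_intros) auto
  qed
  have int: "(\<lambda>u. Im (H (Complex u (\<theta> i)))) integrable_on S" for i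
    unfolding spike by (rule integrable_continuous_real[OF cont])
  have bound: "norm (Im (H (Complex u (\<theta> i)))) \<le> h u" if u: "u \<in> S" for i u
  proof -
    have uAB: "u \<in> {A..B}" using u by (simp add: S_def)
    have "norm (euler_log K (exp (Complex u (\<theta> i)))) \<le>
       norm (exp (Complex u (\<theta> i)) * of_real (ln (real K + 1))) +
       norm (\<Sum>k=1..K. Ln (1 + exp (Complex u (\<theta> i)) / of_nat k))"
      unfolding euler_log_def by (rule norm_triangle_ineq4)
    also have "norm (exp (Complex u (\<theta> i)) * of_real (ln (real K + 1))) \<le> exp B * ln (real K + 1)"
      using uAB by (simp add: norm_mult mult_right_mono)
    also have "norm (\<Sum>k=1..K. Ln (1 + exp (Complex u (\<theta> i)) / of_nat k)) \<le> (\<Sum>k=1..K. g k u)"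
    proof (rule sum_norm_le)
      fix k assume k: "k \<in> {1..K}"
      show "norm (Ln (1 + exp (Complex u (\<theta> i)) / of_nat k)) \<le> g k u"
        unfolding g_def
        using k u by (intro norm_Ln_one_plus_exp_le uAB nz) (auto simp: S_def)
    qed
    finally have N: "norm (euler_log K (exp (Complex u (\<theta> i)))) \<le> exp B * ln (real K + 1) + (\<Sum>k=1..K. g k u)"
      by simp
    have D: "x ^ Suc n \<le> norm ((Complex u (\<theta> i) + complex_of_real \<alpha>) * (exp (Complex u (\<theta> i)) - complex_of_real x) ^ Suc n)"
      unfolding norm_mult norm_power
      using mult_mono[OF w_ge[of u i] power_mono[OF e_ge[of u i], of "Suc n"]] x by simp
    have "norm (Im (H (Complex u (\<theta> i)))) \<le> norm (H (Complex u (\<theta> i)))"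
      using abs_Im_le_cmod by simp
    also have "\<dots> \<le> h u" unfolding H_def h_def norm_divide
      using N D x by (intro frac_le) (auto intro: order_trans[OF norm_ge_zero])
    finally show ?thesis .
  qed
  have lim: "(\<lambda>i. Im (H (Complex u (\<theta> i)))) \<longlonglongrightarrow> (- 1) ^ n * pi * q u" if u: "u \<in> S" for u
  proof -
    define R where "R = - exp u * ln (real K + 1) - (\<Sum>k=1..K. ln \<bar>1 - exp u / real k\<bar>)"
    define m where "m = real (card {k\<in>{1..K}. real k < exp u})"
    have e: "(\<lambda>i. exp (Complex u (\<theta> i))) \<longlonglongrightarrow> complex_of_real (- exp u)"
    proof -
      have "(\<lambda>i. exp (Complex u (\<theta> i))) \<longlonglongrightarrow> of_real (exp u) * cis pi"
        unfolding exp_Complex by (intro tendsto_mult tendsto_const tendsto_cis \<theta>(1))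
      then show ?thesis by simp
    qed
    have s: "(\<Sum>k=1..K. if real k < exp u then pi else 0) = pi * m"
      unfolding m_def by (simp add: sum.If_cases Int_def conj_commute)
    have "(\<lambda>i. euler_log K (exp (Complex u (\<theta> i)))) \<longlonglongrightarrow>
        complex_of_real (- exp u) * of_real (ln (real K + 1)) -
        (\<Sum>k=1..K. Complex (ln \<bar>1 - exp u / real k\<bar>) (if real k < exp u then pi else 0))"
      unfolding euler_log_def using nonint[OF u]
      by (intro tendsto_diff tendsto_mult tendsto_const e tendsto_sum tendsto_Ln_one_plus_exp \<theta> \<theta>0) auto
    also have "complex_of_real (- exp u) * of_real (ln (real K + 1)) -
        (\<Sum>k=1..K. Complex (ln \<bar>1 - exp u / real k\<bar>) (if real k < exp u then pi else 0)) = Complex R (- pi * m)"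
      by (simp add: complex_eq_iff R_def s[symmetric])
    finally have N: "(\<lambda>i. euler_log K (exp (Complex u (\<theta> i)))) \<longlonglongrightarrow> Complex R (- pi * m)" .
    have w: "(\<lambda>i. Complex u (\<theta> i) + complex_of_real \<alpha>) \<longlonglongrightarrow> Complex (u + \<alpha>) pi"
    proof -
      have "(\<lambda>i. Complex (u + \<alpha>) (\<theta> i)) \<longlonglongrightarrow> Complex (u + \<alpha>) pi"
        by (intro tendsto_Complex tendsto_const \<theta>(1))
      moreover have "Complex u (\<theta> i) + complex_of_real \<alpha> = Complex (u + \<alpha>) (\<theta> i)" for i
        by (simp add: complex_eq_iff)
      ultimately show ?thesis by simp
    qed
    have E: "(\<lambda>i. exp (Complex u (\<theta> i)) - complex_of_real x) \<longlonglongrightarrow> complex_of_real (- exp u - x)"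
      using tendsto_diff[OF e tendsto_const[of "complex_of_real x"]] by simp
    have ex: "exp u + x > 0" using x by (simp add: add_pos_pos)
    have nz': "Complex (u + \<alpha>) pi * complex_of_real (- exp u - x) ^ Suc n \<noteq> 0"
    proof -
      have "complex_of_real (- exp u - x) \<noteq> 0" using ex by (simp only: of_real_eq_0_iff)
      moreover have "Complex (u + \<alpha>) pi \<noteq> 0" by (simp add: complex_eq_iff)
      ultimately show ?thesis by simp
    qed
    have "(\<lambda>i. H (Complex u (\<theta> i))) \<longlonglongrightarrow>
        Complex R (- pi * m) / (Complex (u + \<alpha>) pi * complex_of_real (- exp u - x) ^ Suc n)"
      unfolding H_def by (intro tendsto_divide tendsto_mult tendsto_power N w E nz')
    from tendsto_Im[OF this] show ?thesis
      unfolding Im_cut_limit[OF ex] by (simp only: q_def cut_density_def R_def m_def ln_exp)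
  qed
  have conv: "(\<lambda>u. (- 1) ^ n * pi * q u) integrable_on S"
      "(\<lambda>i. integral S (\<lambda>u. Im (H (Complex u (\<theta> i))))) \<longlonglongrightarrow> integral S (\<lambda>u. (- 1) ^ n * pi * q u)"
    using dominated_convergence[OF int h_int bound lim] by auto
  have "(\<lambda>u. ((- 1) ^ n / pi) * ((- 1) ^ n * pi * q u)) integrable_on S"
    by (intro integrable_on_mult_right conv)
  then show "q integrable_on S" by (simp flip: power_mult_distrib)
  show "(\<lambda>i. integral {A..B} (\<lambda>u. Im (H (Complex u (\<theta> i))))) \<longlonglongrightarrow> (- 1) ^ n * pi * integral S q"
    using conv(2) unfolding spike(2) integral_mult_right by simp
qed

section \<open>The derivative at finite K, up to the vertical edges\<close>

lemma one_plus_divide_notin_nonpos_Reals: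
  fixes z :: complex
  assumes "z \<notin> \<real>\<^sub>\<le>\<^sub>0" "k \<ge> 1"
  shows "1 + z / of_nat k \<notin> \<real>\<^sub>\<le>\<^sub>0"
proof
  assume "1 + z / of_nat k \<in> \<real>\<^sub>\<le>\<^sub>0"
  hence "1 + Re z / real k \<le> 0" "Im z = 0"
    using assms(2) by (auto simp: complex_nonpos_Reals_iff Re_divide_of_nat Im_divide_of_nat)
  hence "Re z / real k < 0" by linarith
  hence "Re z \<le> 0" using assms(2) by (simp add: divide_less_0_iff)
  with \<open>Im z = 0\<close> assms(1) show False by (simp add: complex_nonpos_Reals_iff)
qed

lemma holomorphic_euler_log: "euler_log K holomorphic_on - \<real>\<^sub>\<le>\<^sub>0"
proof -
  have "(\<lambda>z. z * of_real (ln (real K + 1)) - (\<Sum>k=1..K. Ln (1 + z / of_nat k))) holomorphic_on - \<real>\<^sub>\<le>\<^sub>0"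
    using one_plus_divide_notin_nonpos_Reals by (intro holomorphic_intros) auto
  then show ?thesis unfolding euler_log_def[abs_def] .
qed

lemma euler_log_cnj:
  assumes "z \<notin> \<real>\<^sub>\<le>\<^sub>0"
  shows "euler_log K (cnj z) = cnj (euler_log K z)"
proof -
  have "Ln (1 + cnj z / of_nat k) = cnj (Ln (1 + z / of_nat k))" if "k \<in> {1..K}" for k
    using cnj_Ln[OF one_plus_divide_notin_nonpos_Reals[OF assms]] that by simp
  then show ?thesis unfolding euler_log_def by simp
qed

lemma euler_log_of_real:
  assumes "p > 0"
  shows "euler_log K (complex_of_real p) = of_real (p * ln (real K + 1) - (\<Sum>k=1..K. ln (1 + p / real k)))"
proof -
  have "Ln (1 + complex_of_real p / of_nat k) = of_real (ln (1 + p / real k))" for k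
  proof -
    have "1 + p / real k > 0" using assms by (simp add: add_pos_nonneg)
    then show ?thesis using Ln_of_real[of "1 + p / real k"] by simp
  qed
  then show ?thesis unfolding euler_log_def by simp
qed

text \<open>By residues the contour integral is the same for every height \<open>\<theta> i\<close>,
  so the estimate survives the limit of the heights; division by \<open>2 * pi\<close> turns
  \<open>4 * pi * b\<close> into \<open>2 * b\<close>. The vertical edges remain as an explicit
  error, as they vanish only with growing \<open>K\<close>.\<close>

lemma deriv_euler_quotient_approx:
  fixes \<alpha> x A B b :: real and n K :: nat
  assumes x: "exp (-\<alpha>) < x" and AB: "A < -\<alpha>" "ln x < B"
  defines "q \<equiv> \<lambda>u. cut_density K \<alpha> (exp u) / (((u + \<alpha>)\<^sup>2 + pi\<^sup>2) * (exp u + x) ^ Suc n)"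
    and "H \<equiv> \<lambda>w. euler_log K (exp w) / ((w + complex_of_real \<alpha>) * (exp w - complex_of_real x) ^ Suc n)"
    and "S \<equiv> {A..B} - (\<lambda>k. ln (real k)) ` {1..K}"
  assumes bnd: "\<And>u v. u \<in> {A, B} \<Longrightarrow> \<bar>v\<bar> < pi \<Longrightarrow> norm (H (Complex u v)) \<le> b"
  shows "norm ((deriv ^^ n) (\<lambda>z. euler_log K z / (z * (Ln z + \<alpha>))) (complex_of_real x) / fact n
      + euler_log K (complex_of_real (exp (-\<alpha>))) / (complex_of_real (exp (-\<alpha>)) - complex_of_real x) ^ Suc n
      + of_real ((- 1) ^ n * integral S q)) \<le> 2 * b"
    (is "norm (?D + ?P + _) \<le> _")
proof -
  have x0: "x > 0" using x exp_gt_zero[of "-\<alpha>"] by linarith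
  have lx: "-\<alpha> < ln x" using x x0 by (metis exp_less_cancel_iff exp_ln)
  have AB': "A < B" using AB lx by linarith
  define \<theta> where "\<theta> = (\<lambda>i. pi - inverse (real (Suc i)))"
  have \<theta>_lim: "\<theta> \<longlonglongrightarrow> pi"
    unfolding \<theta>_def using tendsto_diff[OF tendsto_const[of pi] LIMSEQ_inverse_real_of_nat] by simp
  have \<theta>: "pi / 2 \<le> \<theta> i" "\<theta> i < pi" "0 < \<theta> i" for i
  proof -
    have "inverse (real (Suc i)) \<le> 1" "0 < inverse (real (Suc i))" by (simp_all add: field_simps)
    with pi_gt3 show "pi / 2 \<le> \<theta> i" "\<theta> i < pi" "0 < \<theta> i" unfolding \<theta>_def by linarith+
  qed
  define J where "J = (\<lambda>i. integral {A..B} (\<lambda>u. Im (H (Complex u (\<theta> i)))))"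
  have J: "J \<longlonglongrightarrow> (- 1) ^ n * pi * integral S q"
    unfolding J_def H_def q_def S_def using \<theta> by (intro tendsto_integral_cut AB' x0 \<theta>_lim)
  have le: "norm (2 * pi * \<i> * (?D + ?P) + 2 * \<i> * of_real (J i)) \<le> 4 * pi * b" for i
  proof -
    define \<rho> where "\<rho> = path_image (rectpath (Complex A (- \<theta> i)) (Complex B (\<theta> i)))"
    have Im: "\<bar>Im w\<bar> < pi" if "w \<in> \<rho>" for w
      using rectpath_strip[OF \<theta>(3,2) AB', of i] that unfolding \<rho>_def by auto
    have nz: "w + complex_of_real \<alpha> \<noteq> 0" if "w \<in> \<rho>" for w
    proof
      assume "w + complex_of_real \<alpha> = 0"
      hence "w = complex_of_real (- \<alpha>)" by (simp add: eq_neg_iff_add_eq_0)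
      with that rectpath_avoids_real[OF \<theta>(3), of A "-\<alpha>" B i] AB lx show False by (simp add: \<rho>_def)
    qed
    have nx: "exp w - complex_of_real x \<noteq> 0" if "w \<in> \<rho>" for w
    proof
      assume "exp w - complex_of_real x = 0"
      hence "w = complex_of_real (ln x)" using exp_eq_of_real_strip[OF Im[OF that] x0] by simp
      with that rectpath_avoids_real[OF \<theta>(3), of A "ln x" B i] AB lx show False by (simp add: \<rho>_def)
    qed
    have "norm (contour_integral (rectpath (Complex A (- \<theta> i)) (Complex B (\<theta> i))) H
           + 2 * \<i> * of_real (integral {A..B} (\<lambda>u. Im (H (Complex u (\<theta> i)))))) \<le> 4 * pi * b"
    proof (rule contour_integral_rectpath_symmetric[OF AB' \<theta>(3,2)])
      have "continuous_on \<rho> (\<lambda>w. euler_log K (exp w))"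
        using exp_strip_notin_nonpos_Reals Im
        by (intro continuous_on_compose2[OF holomorphic_on_imp_continuous_on[OF holomorphic_euler_log]]
             continuous_intros) auto
      then show "continuous_on (path_image (rectpath (Complex A (- \<theta> i)) (Complex B (\<theta> i)))) H"
        unfolding H_def \<rho>_def[symmetric] using nz nx by (intro continuous_intros) simp_all
      fix u assume "u \<in> {A..B}"
      have c: "Complex u (- \<theta> i) = cnj (Complex u (\<theta> i))" by (simp add: complex_eq_iff)
      have "exp (Complex u (\<theta> i)) \<notin> \<real>\<^sub>\<le>\<^sub>0"
        using \<theta>[of i] by (intro exp_strip_notin_nonpos_Reals) simp
      from euler_log_cnj[OF this] have "euler_log K (exp (cnj (Complex u (\<theta> i)))) = cnj (euler_log K (exp (Complex u (\<theta> i))))"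
        by (simp add: exp_cnj)
      then show "H (Complex u (- \<theta> i)) = cnj (H (Complex u (\<theta> i)))"
        unfolding c H_def by (simp add: exp_cnj)
    next
      fix u v assume "u \<in> {A, B}" "\<bar>v\<bar> \<le> \<theta> i"
      then show "norm (H (Complex u v)) \<le> b" using bnd \<theta>(2)[of i] by force
    qed
    moreover have "contour_integral (rectpath (Complex A (- \<theta> i)) (Complex B (\<theta> i))) H = 2 * pi * \<i> * (?D + ?P)"
      unfolding H_def by (rule contour_integral_exp_rectpath[OF holomorphic_euler_log x \<theta>(3,2) AB])
    ultimately show ?thesis by (simp add: J_def)
  qed
  have "(\<lambda>i. norm (2 * pi * \<i> * (?D + ?P) + 2 * \<i> * of_real (J i)))
      \<longlonglongrightarrow> norm (2 * pi * \<i> * (?D + ?P) + 2 * \<i> * of_real ((- 1) ^ n * pi * integral S q))"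
    by (intro tendsto_norm tendsto_add tendsto_mult tendsto_const tendsto_of_real J)
  hence "norm (2 * pi * \<i> * (?D + ?P) + 2 * \<i> * of_real ((- 1) ^ n * pi * integral S q)) \<le> 4 * pi * b"
    by (rule LIMSEQ_le_const2) (use le in blast)
  also have "2 * pi * \<i> * (?D + ?P) + 2 * \<i> * of_real ((- 1) ^ n * pi * integral S q) =
     2 * pi * \<i> * (?D + ?P + of_real ((- 1) ^ n * integral S q))"
    by (simp add: algebra_simps)
  finally have "2 * pi * norm (?D + ?P + of_real ((- 1) ^ n * integral S q)) \<le> 2 * pi * (2 * b)"
    by (simp add: norm_mult)
  then show ?thesis by simp
qed

section \<open>Bounds on the vertical sides and the limit\<close>

text \<open>Since \<open>K\<close> is even, the radius differs from each \<open>k\<close> by at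
  least \<open>1 / 2\<close>, so \<open>1 + z / k\<close> has modulus at least
  \<open>1 / (2 * k)\<close>. Each of the \<open>K\<close> logarithms is thus
  \<open>O(ln K)\<close>.\<close>

lemma norm_euler_log_le_half_integer:
  assumes z: "norm z = (real K + 1) / 2" "z \<notin> \<real>\<^sub>\<le>\<^sub>0" and K: "even K" "K \<ge> 2"
  shows "norm (euler_log K z) \<le> real K * (2 * ln (2 * real K + 2) + pi)"
proof -
  define T where "T = (real K + 1) / 2"
  have T: "norm z = T" "T \<le> real K" "T \<ge> 1" using z K by (auto simp: T_def)
  obtain M where M: "K = 2 * M" using K by (elim evenE)
  hence TM: "T = real M + 1 / 2" by (simp add: T_def)
  have Ln_le: "norm (Ln (1 + z / of_nat k)) \<le> ln (2 * real K + 2) + pi" if k: "k \<in> {1..K}" for k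
  proof -
    define v where "v = 1 + z / of_nat k"
    have v0: "v \<noteq> 0"
    proof
      assume "v = 0"
      with one_plus_divide_notin_nonpos_Reals[of z k] z(2) k show False by (simp add: v_def)
    qed
    have n: "norm (z / of_nat k) = T / real k" using T by (simp add: norm_divide)
    have "norm v \<le> 1 + T / real k" unfolding v_def using norm_triangle_ineq[of 1 "z / of_nat k"] n by simp
    also have "T / real k \<le> T" using T k by (simp add: divide_le_eq)
    finally have up: "norm v \<le> 2 * real K + 2" using T by linarith
    have "\<bar>1 - T / real k\<bar> \<le> norm v" unfolding v_def
      using norm_triangle_ineq3[of 1 "- (z / of_nat k)"] n by simp
    moreover have "1 / (2 * real k) \<le> \<bar>1 - T / real k\<bar>"
    proof -
      have "\<bar>1 - T / real k\<bar> = \<bar>real k - T\<bar> / real k"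
      proof -
        have "1 - T / real k = (real k - T) / real k" using k by (simp add: diff_divide_distrib)
        then show ?thesis by simp
      qed
      moreover have "1 / 2 \<le> \<bar>real k - T\<bar>"
      proof (cases "k \<le> M")
        case True
        hence "real k \<le> real M" by simp
        then show ?thesis using TM by linarith
      next
        case False
        hence "real k \<ge> real M + 1" by linarith
        then show ?thesis using TM by linarith
      qed
      hence "(1 / 2) / real k \<le> \<bar>real k - T\<bar> / real k" by (intro divide_right_mono) auto
      ultimately show ?thesis by simp
    qed
    moreover have "1 / (2 * real K + 2) \<le> 1 / (2 * real k)" using k by (intro divide_left_mono) auto
    ultimately have lo: "1 / (2 * real K + 2) \<le> norm v" by linarith
    have "ln (norm v) \<le> ln (2 * real K + 2)" using up v0 by (intro ln_mono) auto
    moreover have "ln (1 / (2 * real K + 2)) \<le> ln (norm v)" using lo by (intro ln_mono) auto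
    hence "- ln (2 * real K + 2) \<le> ln (norm v)" by (simp add: ln_div)
    ultimately have "\<bar>ln (norm v)\<bar> \<le> ln (2 * real K + 2)" by linarith
    with norm_Ln_le_abs_ln[OF v0] show ?thesis unfolding v_def[symmetric] by linarith
  qed
  have "norm (euler_log K z) \<le> norm (z * of_real (ln (real K + 1))) + norm (\<Sum>k=1..K. Ln (1 + z / of_nat k))"
    unfolding euler_log_def by (rule norm_triangle_ineq4)
  also have "norm (z * of_real (ln (real K + 1))) = T * ln (real K + 1)" using T by (simp add: norm_mult)
  also have "T * ln (real K + 1) \<le> real K * ln (2 * real K + 2)"
    using T by (intro mult_mono ln_mono) auto
  also have "norm (\<Sum>k=1..K. Ln (1 + z / of_nat k)) \<le> (\<Sum>k=1..K. ln (2 * real K + 2) + pi)"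
    by (rule sum_norm_le[OF Ln_le])
  finally show ?thesis by (simp add: algebra_simps)
qed

text \<open>All terms of N_K vanish at 0. At the radius \<open>1 / (K + 1) ^ 2\<close> of the left
  edge this outweighs the number of terms.\<close>

lemma norm_euler_log_le_small:
  assumes z: "norm z < 1 / 2"
  shows "norm (euler_log K z) \<le> norm z * (3 * real K)"
proof -
  have "norm (Ln (1 + z / of_nat k)) \<le> 2 * norm z" if k: "k \<in> {1..K}" for k
  proof -
    have le: "norm (z / of_nat k) \<le> norm z" using k by (simp add: norm_divide divide_le_eq mult_le_cancel_left1)
    hence "norm (Ln (1 + z / of_nat k)) \<le> 2 * norm (z / of_nat k)" using z by (intro norm_Ln_le) linarith
    then show ?thesis using le by linarith
  qed
  hence "norm (\<Sum>k=1..K. Ln (1 + z / of_nat k)) \<le> (\<Sum>k=1..K. 2 * norm z)"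
    by (rule sum_norm_le)
  moreover have "ln (real K + 1) \<le> real K" using ln_add_one_self_le_self[of "real K"] by (simp add: add.commute)
  hence "norm (z * of_real (ln (real K + 1))) \<le> norm z * real K"
    by (simp add: norm_mult mult_left_mono)
  moreover have "norm (euler_log K z) \<le> norm (z * of_real (ln (real K + 1))) + norm (\<Sum>k=1..K. Ln (1 + z / of_nat k))"
    unfolding euler_log_def by (rule norm_triangle_ineq4)
  ultimately show ?thesis by (simp add: algebra_simps)
qed

lemma integrable_cut_density:
  fixes \<alpha> x A B :: real
  assumes "A < B" "x > 0"
  shows "(\<lambda>u. cut_density K \<alpha> (exp u) / (((u + \<alpha>)\<^sup>2 + pi\<^sup>2) * (exp u + x) ^ Suc n))
    integrable_on ({A..B} - (\<lambda>k. ln (real k)) ` {1..K})"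
proof (rule tendsto_integral_cut(1)[OF assms])
  \<comment> \<open>Any admissible sequence of heights serves, since the integrability claim does
    not mention it.\<close>
  show "(\<lambda>i. pi - inverse (real (Suc i))) \<longlonglongrightarrow> pi"
    using tendsto_diff[OF tendsto_const[of pi] LIMSEQ_inverse_real_of_nat] by simp
  fix i
  have "inverse (real (Suc i)) \<le> 1" "0 < inverse (real (Suc i))" by (simp_all add: field_simps)
  with pi_gt3 show "pi / 2 \<le> pi - inverse (real (Suc i))" "pi - inverse (real (Suc i)) < pi"
    by linarith+
qed

text \<open>\<open>\<delta>\<close> bounds the cut integral by its part over \<open>u\<close> in
  \<open>[-2, -1]\<close>, an interval of length one; the two summands of \<open>b\<close> bound the
  integrand on the right and on the left edge. Of the size conditions on \<open>K\<close>, the one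
  with \<open>4 * x\<close> keeps the image of the right edge at distance \<open>(K + 1) / 4\<close>
  from \<open>x\<close>, the one with \<open>exp (\<alpha> + 1)\<close> keeps both edges at distance
  1 from \<open>-\<alpha>\<close>, and the last keeps the image of the left edge at distance
  \<open>x / 2\<close> from \<open>x\<close>.\<close>

lemma deriv_euler_quotient_lower_bound:
  fixes \<alpha> x :: real and n K :: nat
  assumes \<alpha>: "\<alpha> \<ge> 0" and x: "exp (-\<alpha>) < x" and n: "n \<ge> 1"
    and K: "even K" "K \<ge> 3" "4 * x \<le> real K + 1" "2 * exp (\<alpha> + 1) \<le> real K + 1" "2 \<le> (real K + 1) * x"
  defines "\<delta> \<equiv> exp (-2) * (1 - ln 2) / (((\<alpha> + 2)\<^sup>2 + pi\<^sup>2) * (1 + x) ^ Suc n)"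
    and "b \<equiv> 16 * (2 * ln (2 * real K + 2) + pi) / (real K + 1) + 3 / (real K + 1) / (x / 2) ^ Suc n"
  shows "\<delta> - 2 * b \<le> (- 1) ^ (n - 1) *
     Re ((deriv ^^ n) (\<lambda>z. euler_log K z / (z * (Ln z + \<alpha>))) (complex_of_real x) / fact n)"
proof -
  \<comment> \<open>The left edge recedes fast enough for \<open>3 * K * exp A\<close> to vanish as
    \<open>K\<close> grows; the right edge stops where \<open>cut_density_nonneg\<close>
    does.\<close>
  define A where "A = - 2 * ln (real K + 1)"
  define B where "B = ln ((real K + 1) / 2)"
  define q where "q = (\<lambda>u. cut_density K \<alpha> (exp u) / (((u + \<alpha>)\<^sup>2 + pi\<^sup>2) * (exp u + x) ^ Suc n))"
  define H where "H = (\<lambda>w. euler_log K (exp w) / ((w + complex_of_real \<alpha>) * (exp w - complex_of_real x) ^ Suc n))"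
  define S where "S = {A..B} - (\<lambda>k. ln (real k)) ` {1..K}"
  define p where "p = exp (-\<alpha>)"
  have x0: "x > 0" using x exp_gt_zero[of "-\<alpha>"] by linarith
  have p: "0 < p" "p \<le> 1" "p < x" using \<alpha> x by (auto simp: p_def)
  have lnK: "ln (real K + 1) \<ge> \<alpha> + 1" using K(4) exp_gt_zero[of "\<alpha> + 1"] by (subst ln_ge_iff) (auto intro: order_trans[rotated])
  have A: "A \<le> -\<alpha> - 1" "A \<le> -2" using lnK \<alpha> by (auto simp: A_def)
  have eB: "exp B = (real K + 1) / 2" by (simp add: B_def)
  have eA: "exp A = 1 / (real K + 1)\<^sup>2"
    by (simp add: A_def exp_minus exp_double power2_eq_square field_simps)
  have B0: "B \<ge> \<alpha> + 1" unfolding B_def using K(4) by (subst ln_ge_iff) auto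
  have xB: "ln x < B" unfolding B_def using x0 K(3) by (subst ln_less_cancel_iff) auto
  have K1: "(0::real) < real K + 1" by simp
  have term1: "0 \<le> 16 * (2 * ln (2 * real K + 2) + pi) / (real K + 1)" by (intro divide_nonneg_nonneg mult_nonneg_nonneg add_nonneg_nonneg) auto
  have term2: "0 \<le> 3 / (real K + 1) / (x / 2) ^ Suc n" using x0 by simp
  have bnd: "norm (H (Complex u v)) \<le> b" if u: "u \<in> {A, B}" and v: "\<bar>v\<bar> < pi" for u v
  proof -
    have nonpos: "exp (Complex u v) \<notin> \<real>\<^sub>\<le>\<^sub>0" using v by (intro exp_strip_notin_nonpos_Reals) auto
    have Re_le: "\<bar>u + \<alpha>\<bar> \<le> norm (Complex u v + complex_of_real \<alpha>)"
      using abs_Re_le_cmod[of "Complex u v + complex_of_real \<alpha>"] by simp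
    from u consider "u = A" | "u = B" by blast
    then show ?thesis
    proof cases
      case 1
      have small: "norm (exp (Complex u v)) = 1 / (real K + 1)\<^sup>2" using 1 eA by simp
      have "(1::real) / (real K + 1)\<^sup>2 \<le> 1 / 4\<^sup>2" using K(2) by (intro divide_left_mono power_mono) auto
      hence "norm (exp (Complex u v)) < 1 / 2" unfolding small by simp
      from norm_euler_log_le_small[OF this, of K]
      have "norm (euler_log K (exp (Complex u v))) \<le> 1 / (real K + 1)\<^sup>2 * (3 * real K)" unfolding small .
      also have "\<dots> \<le> 1 / (real K + 1)\<^sup>2 * (3 * (real K + 1))" by (intro mult_left_mono) auto
      also have "\<dots> = 3 / (real K + 1)" unfolding power2_eq_square using K1 by (simp only: times_divide_eq_left mult_1 mult_divide_mult_cancel_right)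
      finally have N: "norm (euler_log K (exp (Complex u v))) \<le> 3 / (real K + 1)" .
      have "1 / (real K + 1)\<^sup>2 \<le> x / 2"
      proof -
        have "2 * 1 \<le> ((real K + 1) * x) * (real K + 1)" using K(5) by (intro mult_mono) auto
        moreover have "1 / c\<^sup>2 \<le> x / 2" if "2 * 1 \<le> (c * x) * c" "c > 0" for c
          using that by (subst pos_divide_le_eq) (simp_all add: power2_eq_square mult_ac)
        ultimately show ?thesis using K1 by blast
      qed
      hence E: "x / 2 \<le> norm (exp (Complex u v) - complex_of_real x)"
        using norm_triangle_ineq3[of "complex_of_real x" "exp (Complex u v)"] small x0
        by (simp add: norm_minus_commute)
      have D: "(x / 2) ^ Suc n \<le> norm ((Complex u v + complex_of_real \<alpha>) * (exp (Complex u v) - complex_of_real x) ^ Suc n)"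
        unfolding norm_mult norm_power
        using mult_mono[of 1 "norm (Complex u v + complex_of_real \<alpha>)", OF _ power_mono[OF E, of "Suc n"]] x0 Re_le 1 A
        by simp
      have "norm (H (Complex u v)) \<le> 3 / (real K + 1) / (x / 2) ^ Suc n"
        unfolding H_def norm_divide by (rule frac_le[OF _ N _ D]) (use x0 in auto)
      then show ?thesis unfolding b_def using term1 by linarith
    next
      case 2
      have nz: "norm (exp (Complex u v)) = (real K + 1) / 2" using 2 eB by simp
      have N: "norm (euler_log K (exp (Complex u v))) \<le> real K * (2 * ln (2 * real K + 2) + pi)"
        using K by (intro norm_euler_log_le_half_integer nz nonpos) auto
      have E: "(real K + 1) / 4 \<le> norm (exp (Complex u v) - complex_of_real x)"
        using norm_triangle_ineq2[of "exp (Complex u v)" "complex_of_real x"] nz x0 K(3) by simp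
      \<comment> \<open>Here \<open>n \<ge> 1\<close> makes the kernel of order at least two, enough
        against the growth \<open>K * ln K\<close> of N_K.\<close>
      have "((real K + 1) / 4)\<^sup>2 \<le> ((real K + 1) / 4) ^ Suc n"
        using K(2) n by (intro power_increasing) auto
      also have "\<dots> \<le> norm (exp (Complex u v) - complex_of_real x) ^ Suc n"
        by (intro power_mono E) auto
      finally have E2: "((real K + 1) / 4)\<^sup>2 \<le> norm (exp (Complex u v) - complex_of_real x) ^ Suc n" .
      have D: "((real K + 1) / 4)\<^sup>2 \<le> norm ((Complex u v + complex_of_real \<alpha>) * (exp (Complex u v) - complex_of_real x) ^ Suc n)"
        unfolding norm_mult norm_power
        using mult_mono[of 1 "norm (Complex u v + complex_of_real \<alpha>)", OF _ E2] Re_le 2 B0 \<alpha>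
        by simp
      have X: "0 \<le> 2 * ln (2 * real K + 2) + pi" by (intro add_nonneg_nonneg mult_nonneg_nonneg) auto
      have "norm (H (Complex u v)) \<le> real K * (2 * ln (2 * real K + 2) + pi) / ((real K + 1) / 4)\<^sup>2"
        unfolding H_def norm_divide by (rule frac_le[OF _ N _ D]) (use X in auto)
      also have "\<dots> \<le> (real K + 1) * (2 * ln (2 * real K + 2) + pi) / ((real K + 1) / 4)\<^sup>2"
        by (intro divide_right_mono mult_right_mono X) auto
      also have "c * y / (c / 4)\<^sup>2 = 16 * y / c" if "c > 0" for c y :: real
        using that by (simp add: power2_eq_square field_simps)
      from this[OF K1] have "(real K + 1) * (2 * ln (2 * real K + 2) + pi) / ((real K + 1) / 4)\<^sup>2 =
        16 * (2 * ln (2 * real K + 2) + pi) / (real K + 1)" .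
      finally show ?thesis unfolding b_def using term2 by linarith
    qed
  qed
  define D where "D = (deriv ^^ n) (\<lambda>z. euler_log K z / (z * (Ln z + \<alpha>))) (complex_of_real x) / fact n"
  define r where "r = p * ln (real K + 1) - (\<Sum>k=1..K. ln (1 + p / real k))"
  define s :: real where "s = (- 1) ^ (n - 1)"
  have s: "s * (- 1) ^ n = - 1" "\<bar>s\<bar> = 1"
    using n by (cases n; simp add: s_def flip: power_mult_distrib)+
  have "norm (D + euler_log K (complex_of_real p) / (complex_of_real p - complex_of_real x) ^ Suc n
      + of_real ((- 1) ^ n * integral S q)) \<le> 2 * b"
    unfolding q_def S_def D_def p_def
    by (rule deriv_euler_quotient_approx[OF x _ xB]) (use A bnd in \<open>auto simp: H_def\<close>)
  hence "norm (D + of_real (r / (p - x) ^ Suc n) + of_real ((- 1) ^ n * integral S q)) \<le> 2 * b"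
    unfolding euler_log_of_real[OF p(1)] r_def by simp
  hence "\<bar>Re D + r / (p - x) ^ Suc n + (- 1) ^ n * integral S q\<bar> \<le> 2 * b"
    using abs_Re_le_cmod[of "D + of_real (r / (p - x) ^ Suc n) + of_real ((- 1) ^ n * integral S q)"] by simp
  hence le: "\<bar>s * (Re D + r / (p - x) ^ Suc n + (- 1) ^ n * integral S q)\<bar> \<le> 2 * b"
    unfolding abs_mult s(2) by simp
  have eq: "s * (Re D + r / (p - x) ^ Suc n + (- 1) ^ n * integral S q) =
      s * Re D + s * (r / (p - x) ^ Suc n) - integral S q"
    using s(1) by (simp add: distrib_left mult.assoc[symmetric])
  \<comment> \<open>Since \<open>p < x\<close>, the power carries the sign
    \<open>(-1) ^ Suc n\<close>; after multiplication by \<open>s\<close> the term has the sign of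
    \<open>r\<close> for every \<open>n\<close>.\<close>
  have "s * (r / (p - x) ^ Suc n) \<le> 0"
  proof -
    have "p - x = (- 1) * (x - p)" by simp
    hence "(p - x) ^ Suc n = (- 1) ^ Suc n * (x - p) ^ Suc n" by (simp only: power_mult_distrib)
    hence "s * (r / (p - x) ^ Suc n) = (s * (- 1) ^ n) * (- (r / (x - p) ^ Suc n))"
      by (cases "even n") simp_all
    also have "\<dots> = r / (x - p) ^ Suc n" unfolding s(1) by simp
    also have "\<dots> \<le> 0"
      using euler_partial_nonpos[OF p(1,2), of K] p(3) unfolding r_def by (intro divide_nonpos_nonneg) auto
    finally show ?thesis .
  qed
  moreover have "integral S q \<ge> \<delta>"
  proof -
    have ln_ge: "ln (real k) \<ge> 0" if "k \<in> {1..K}" for k using that by simp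
    \<comment> \<open>For these \<open>u\<close> the point \<open>t = exp u\<close> is below 1, left
      of all singularities, so \<open>cut_density_ge\<close> applies.\<close>
    have sub: "{-2..-1} \<subseteq> S"
    proof
      fix u :: real assume u: "u \<in> {-2..-1}"
      have "u \<notin> (\<lambda>k. ln (real k)) ` {1..K}"
      proof
        assume "u \<in> (\<lambda>k. ln (real k)) ` {1..K}"
        then obtain k where "u = ln (real k)" "k \<in> {1..K}" by (rule imageE)
        with ln_ge[OF this(2)] u show False by simp
      qed
      moreover have "u \<in> {A..B}" using u A B0 \<alpha> by simp
      ultimately show "u \<in> S" unfolding S_def by simp
    qed
    have diff: "{-2..-1} - (\<lambda>k. ln (real k)) ` {1..K} = {-2..-1::real}" using sub unfolding S_def by blast
    have q_int: "q integrable_on S"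
      unfolding q_def S_def using A B0 \<alpha> by (intro integrable_cut_density x0) auto
    have q_int': "q integrable_on {-2..-1}"
      using integrable_cut_density[of "-2" "-1" x K \<alpha> n] x0 unfolding diff q_def by simp
    have den: "((u + \<alpha>)\<^sup>2 + pi\<^sup>2) * (exp u + x) ^ Suc n > 0" for u
      using x0 by (intro mult_pos_pos zero_less_power add_pos_pos add_nonneg_pos) auto
    have q_nonneg: "q u \<ge> 0" if "u \<in> S" for u
    proof -
      have ne: "real k \<noteq> exp u" if "k \<in> {1..K}" for k
        using \<open>u \<in> S\<close> that unfolding S_def by (metis DiffD2 imageI ln_exp)
      have "exp u \<le> exp B" using that by (simp add: S_def)
      hence "cut_density K \<alpha> (exp u) \<ge> 0"
        unfolding eB by (intro cut_density_nonneg[OF _ _ \<alpha> ne]) simp_all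
      then show ?thesis unfolding q_def using den[of u] by simp
    qed
    have q_ge: "q u \<ge> \<delta>" if u: "u \<in> {-2..-1}" for u
      unfolding \<delta>_def q_def
    proof (rule frac_le)
      have l2: "ln 2 \<le> (1::real)" using ln_le_minus_one[of 2] by simp
      have "exp (-2) * (1 - ln 2) \<le> exp u * (1 - ln 2)" using u l2 by (intro mult_right_mono) auto
      also have "\<dots> \<le> cut_density K \<alpha> (exp u)" using u K by (intro cut_density_ge) auto
      finally show *: "exp (-2) * (1 - ln 2) \<le> cut_density K \<alpha> (exp u)" .
      show "0 \<le> cut_density K \<alpha> (exp u)" using l2 by (intro order_trans[OF _ *]) simp
      show "0 < ((u + \<alpha>)\<^sup>2 + pi\<^sup>2) * (exp u + x) ^ Suc n" by (rule den)
      have "\<bar>u + \<alpha>\<bar> \<le> \<bar>\<alpha> + 2\<bar>" using u \<alpha> by auto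
      hence "(u + \<alpha>)\<^sup>2 \<le> (\<alpha> + 2)\<^sup>2" by (simp only: abs_le_square_iff)
      moreover have "(exp u + x) ^ Suc n \<le> (1 + x) ^ Suc n" using u x0 by (intro power_mono) auto
      ultimately show "((u + \<alpha>)\<^sup>2 + pi\<^sup>2) * (exp u + x) ^ Suc n \<le> ((\<alpha> + 2)\<^sup>2 + pi\<^sup>2) * (1 + x) ^ Suc n"
        using x0 by (intro mult_mono) auto
    qed
    have "\<delta> = integral {-2..-1::real} (\<lambda>_. \<delta>)" by simp
    also have "\<dots> \<le> integral {-2..-1} q" by (intro integral_le q_int' q_ge) auto
    also have "\<dots> \<le> integral S q" by (intro integral_subset_le sub q_int q_int') (use q_nonneg in auto)
    finally show ?thesis .
  qed
  moreover have "\<delta> - 2 * b \<le> X" if "Y \<le> 0" "\<delta> \<le> I" "\<bar>X + Y - I\<bar> \<le> 2 * b" for X Y I :: real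
    using that by linarith
  ultimately have "\<delta> - 2 * b \<le> s * Re D" using le unfolding eq by blast
  then show ?thesis by (simp only: D_def s_def)
qed

section \<open>Passage to the limit in K and return to real derivatives\<close>

lemma euler_log_eq_ln_Gamma_series:
  assumes "K \<ge> 1"
  shows "euler_log K z = ln_Gamma_series z K + Ln z + z * of_real (ln (real K + 1) - ln (real K))"
  using assms by (simp add: euler_log_def ln_Gamma_series_def Ln_of_nat algebra_simps)

text \<open>Locally uniform convergence of \<open>ln_Gamma_series\<close> passes to derivatives by
  Weierstrass' theorem. A disc inside \<open>Re z > exp (-\<alpha>)\<close> avoids the cut and the
  zero of \<open>Ln z + \<alpha>\<close>, because \<open>ln (norm z) > -\<alpha>\<close>
  there.\<close>

lemma tendsto_deriv_euler_quotient:
  fixes \<alpha> x :: real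
  assumes x: "exp (-\<alpha>) < x"
  shows "(\<lambda>K. (deriv ^^ n) (\<lambda>z. euler_log K z / (z * (Ln z + \<alpha>))) (complex_of_real x))
     \<longlonglongrightarrow> (deriv ^^ n) (\<lambda>z. (ln_Gamma z + Ln z) / (z * (Ln z + \<alpha>))) (complex_of_real x)"
proof -
  define p where "p = exp (-\<alpha>)"
  have p: "0 < p" "p < x" using x by (auto simp: p_def)
  define X where "X = complex_of_real x"
  have "X \<notin> \<int>\<^sub>\<le>\<^sub>0" using p nonpos_Ints_nonpos[of x] by (auto simp: X_def of_real_in_nonpos_Ints_iff)
  then obtain d where d: "d > 0" "uniformly_convergent_on (ball X d) (\<lambda>n z. ln_Gamma_series z n)"
    using ln_Gamma_series_complex_converges' by blast
  define r where "r = min (d / 2) ((x - p) / 2)"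
  have r: "r > 0" "r < d" "r < x - p" using d p by (auto simp: r_def min_def)
  have Re_gt: "Re z > p" if "z \<in> cball X r" for z
    using that abs_Re_le_cmod[of "X - z"] r by (simp add: dist_norm X_def)
  have slit: "z \<notin> \<real>\<^sub>\<le>\<^sub>0" if "z \<in> cball X r" for z
    using Re_gt[OF that] p by (simp add: complex_nonpos_Reals_iff)
  have den: "z * (Ln z + \<alpha>) \<noteq> 0" if "z \<in> cball X r" for z
  proof -
    have z0: "z \<noteq> 0" using slit[OF that] by auto
    have "p < norm z" using Re_gt[OF that] complex_Re_le_cmod[of z] by linarith
    hence "ln p < ln (norm z)" using p by (subst ln_less_cancel_iff) linarith+
    hence "Re (Ln z + \<alpha>) > 0" using z0 by (simp add: p_def)
    hence "Ln z + \<alpha> \<noteq> 0" by (metis less_irrefl zero_complex.sel(1))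
    with z0 show ?thesis by simp
  qed
  define g where "g = (\<lambda>z. 1 / (z * (Ln z + \<alpha>)))"
  have sub: "ball X r \<subseteq> cball X r" "ball X r \<subseteq> ball X d" using r by auto
  have "uniform_limit (ball X d) (\<lambda>n z. ln_Gamma_series z n) ln_Gamma sequentially"
    using d(2) unfolding uniformly_convergent_uniform_limit_iff ln_Gamma_def[symmetric] .
  hence 1: "uniform_limit (ball X r) (\<lambda>n z. ln_Gamma_series z n) ln_Gamma sequentially"
    using sub(2) by (rule uniform_limit_on_subset)
  have c: "(\<lambda>K. ln (real K + 1) - ln (real K)) \<longlonglongrightarrow> 0" by real_asymp
  \<comment> \<open>Multiplying uniform limits requires bounded limit functions; compactness of the
    closed disc provides the bounds.\<close>
  have bounded_image: "bounded (f ` ball X r)" if "f holomorphic_on cball X r" for f :: "complex \<Rightarrow> complex"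
  proof -
    have "compact (f ` cball X r)"
      by (intro compact_continuous_image holomorphic_on_imp_continuous_on that) auto
    then show ?thesis using sub by (meson bounded_subset compact_imp_bounded image_mono)
  qed
  have holos: "g holomorphic_on cball X r" "(\<lambda>z. ln_Gamma z + Ln z) holomorphic_on cball X r"
    unfolding g_def using den slit by (auto intro!: holomorphic_intros)
  have 2: "uniform_limit (ball X r) (\<lambda>K z. complex_of_real (ln (real K + 1) - ln (real K))) (\<lambda>z. 0) sequentially"
    unfolding uniform_limit_iff
  proof (intro allI impI)
    fix e :: real assume "e > 0"
    from tendstoD[OF c this]
    show "\<forall>\<^sub>F K in sequentially. \<forall>z\<in>ball X r. dist (complex_of_real (ln (real K + 1) - ln (real K))) 0 < e"
      by eventually_elim (simp add: dist_norm del: of_real_diff)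
  qed
  have id_holo: "(\<lambda>z. z) holomorphic_on cball X r" by (rule holomorphic_on_ident)
  have zero_holo: "(\<lambda>z. 0) holomorphic_on cball X r" by (rule holomorphic_on_const)
  have "uniform_limit (ball X r)
      (\<lambda>K z. (ln_Gamma_series z K + Ln z + z * of_real (ln (real K + 1) - ln (real K))) * g z)
      (\<lambda>z. (ln_Gamma z + Ln z + z * 0) * g z) sequentially"
    using holos
    by (intro uniform_lim_mult uniform_limit_add uniform_limit_const 1 2 bounded_image id_holo zero_holo)
       simp_all
  hence "uniform_limit (ball X r) (\<lambda>K z. euler_log K z / (z * (Ln z + \<alpha>)))
      (\<lambda>z. (ln_Gamma z + Ln z) / (z * (Ln z + \<alpha>))) sequentially"
    by (rule uniform_limit_cong[THEN iffD1, rotated 2])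
       (auto simp: g_def euler_log_eq_ln_Gamma_series intro!: eventually_mono[OF eventually_ge_at_top[of 1]])
  then show ?thesis unfolding X_def[symmetric]
  proof (rule higher_deriv_complex_uniform_limit)
    have "(\<lambda>z. euler_log K z / (z * (Ln z + \<alpha>))) holomorphic_on ball X r" for K
      using den slit sub
      by (intro holomorphic_intros holomorphic_on_subset[OF holomorphic_euler_log]) auto
    then show "\<forall>\<^sub>F K in sequentially. (\<lambda>z. euler_log K z / (z * (Ln z + \<alpha>))) holomorphic_on ball X r"
      by simp
  qed (use r in auto)
qed

text \<open>The induction carries equality on all of the open set \<open>T\<close>: equality at the
  point \<open>y\<close> alone would say nothing about the next derivative.\<close>

lemma higher_deriv_Re_of_real:
  fixes f :: "complex \<Rightarrow> complex" and g :: "real \<Rightarrow> real"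
  assumes f: "f holomorphic_on S" "open S" and T: "open T" "\<And>y. y \<in> T \<Longrightarrow> complex_of_real y \<in> S"
    and eq: "\<And>y. y \<in> T \<Longrightarrow> g y = Re (f (complex_of_real y))"
  shows "y \<in> T \<Longrightarrow> (deriv ^^ n) g y = Re ((deriv ^^ n) f (complex_of_real y))"
proof (induction n arbitrary: y)
  case (Suc n)
  have "((deriv ^^ n) f has_field_derivative (deriv ^^ Suc n) f (complex_of_real y)) (at (complex_of_real y))"
    by (rule has_field_derivative_higher_deriv[OF f T(2)[OF Suc.prems]])
  hence "((\<lambda>y. (deriv ^^ n) f (complex_of_real y)) has_vector_derivative (deriv ^^ Suc n) f (complex_of_real y)) (at y)"
    by (rule has_vector_derivative_real_field)
  hence "((\<lambda>y. Re ((deriv ^^ n) f (complex_of_real y))) has_vector_derivative Re ((deriv ^^ Suc n) f (complex_of_real y))) (at y)"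
    by (rule bounded_linear.has_vector_derivative[OF bounded_linear_Re])
  hence "((deriv ^^ n) g has_vector_derivative Re ((deriv ^^ Suc n) f (complex_of_real y))) (at y)"
    by (rule has_vector_derivative_transform_within_open[OF _ T(1) Suc.prems]) (simp add: Suc.IH)
  hence "((deriv ^^ n) g has_field_derivative Re ((deriv ^^ Suc n) f (complex_of_real y))) (at y)"
    by (simp add: has_real_derivative_iff_has_vector_derivative)
  then show ?case by (simp add: DERIV_imp_deriv)
qed (simp add: eq)

lemma F_eq_Re:
  assumes "a \<ge> 1" "y > 1 / a"
  shows "F a y = Re ((ln_Gamma (complex_of_real y) + Ln (complex_of_real y)) /
     (complex_of_real y * (Ln (complex_of_real y) + complex_of_real (ln a))))"
proof -
  have a: "0 < 1 / a" using assms by simp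
  have y: "y > 0" using assms a by linarith
  have "y \<notin> \<int>\<^sub>\<le>\<^sub>0" using y nonpos_Ints_nonpos[of y] by auto
  hence "ln (Gamma (y + 1)) = ln_Gamma y + ln y"
    using y ln_mult_pos[OF y Gamma_real_pos[OF y]] by (simp add: Gamma_plus1 ln_Gamma_real_pos)
  moreover have "ln (a * y) = ln y + ln a" using y assms by (simp add: ln_mult)
  ultimately have "complex_of_real (F a y) = (ln_Gamma (complex_of_real y) + Ln (complex_of_real y)) /
     (complex_of_real y * (Ln (complex_of_real y) + complex_of_real (ln a)))"
    unfolding F_def using y by (simp add: ln_Gamma_complex_of_real Ln_of_real)
  then show ?thesis by (metis Re_complex_of_real)
qed

lemma holomorphic_F_complex:
  "(\<lambda>z. (ln_Gamma z + Ln z) / (z * (Ln z + complex_of_real \<alpha>))) holomorphic_on {z. Re z > exp (-\<alpha>)}"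
proof -
  have "z * (Ln z + complex_of_real \<alpha>) \<noteq> 0" "z \<notin> \<real>\<^sub>\<le>\<^sub>0" if z: "Re z > exp (-\<alpha>)" for z
  proof -
    have "Re z > 0" using z exp_gt_zero[of "-\<alpha>"] by linarith
    then show "z \<notin> \<real>\<^sub>\<le>\<^sub>0" by (simp add: complex_nonpos_Reals_iff)
    hence z0: "z \<noteq> 0" by auto
    have "exp (-\<alpha>) < norm z" using z complex_Re_le_cmod[of z] by linarith
    hence "-\<alpha> < ln (norm z)" using z0 exp_less_cancel_iff[of "-\<alpha>" "ln (norm z)"] by simp
    hence "Re (Ln z + \<alpha>) > 0" using z0 by simp
    hence "Ln z + \<alpha> \<noteq> 0" by (metis less_irrefl zero_complex.sel(1))
    with z0 show "z * (Ln z + complex_of_real \<alpha>) \<noteq> 0" by simp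
  qed
  then show ?thesis by (auto intro!: holomorphic_intros)
qed

theorem corollary1p2:
  fixes a x :: real and n :: nat
  assumes "a \<ge> 1" and "x > 1 / a" and "n \<ge> 1"
  shows "(-1) ^ (n - 1) * (deriv ^^ n) (F a) x > 0"
proof -
  define \<alpha> where "\<alpha> = ln a"
  have \<alpha>: "\<alpha> \<ge> 0" "exp (-\<alpha>) = 1 / a" using assms(1) by (auto simp: \<alpha>_def exp_minus inverse_eq_divide)
  have x: "exp (-\<alpha>) < x" using assms(2) \<alpha> by simp
  have x0: "x > 0" using x exp_gt_zero[of "-\<alpha>"] by linarith
  define Q where "Q = (\<lambda>K z. euler_log K z / (z * (Ln z + complex_of_real \<alpha>)))"
  define G where "G = (\<lambda>z. (ln_Gamma z + Ln z) / (z * (Ln z + complex_of_real \<alpha>)))"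
  have deriv_eq: "(deriv ^^ n) (F a) x = Re ((deriv ^^ n) G (complex_of_real x))"
  proof (rule higher_deriv_Re_of_real)
    show "G holomorphic_on {z. Re z > exp (-\<alpha>)}" unfolding G_def by (rule holomorphic_F_complex)
    show "open {z. Re z > exp (-\<alpha>)}" by (rule open_halfspace_Re_gt)
    show "open {1 / a<..}" by simp
    show "complex_of_real y \<in> {z. Re z > exp (-\<alpha>)}" if "y \<in> {1 / a<..}" for y using that \<alpha> by simp
    show "F a y = Re (G (complex_of_real y))" if "y \<in> {1 / a<..}" for y
      unfolding G_def \<alpha>_def using that assms(1) by (intro F_eq_Re) auto
  qed (use assms in auto)
  define s :: real where "s = (- 1) ^ (n - 1)"
  define \<delta> where "\<delta> = exp (-2) * (1 - ln 2) / (((\<alpha> + 2)\<^sup>2 + pi\<^sup>2) * (1 + x) ^ Suc n)"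
  define b where "b = (\<lambda>K. 16 * (2 * ln (2 * real K + 2) + pi) / (real K + 1) + 3 / (real K + 1) / (x / 2) ^ Suc n)"
  have ln2: "ln 2 < (1::real)" using ln_bound[of 2] ln_eq_minus_one[of 2] ln_le_minus_one[of 2] by force
  have \<delta>: "\<delta> > 0"
    unfolding \<delta>_def using x0 ln2 by (intro divide_pos_pos mult_pos_pos add_nonneg_pos zero_less_power) auto
  have "(\<lambda>K. 16 * (2 * ln (2 * real K + 2) + pi) / (real K + 1)) \<longlonglongrightarrow> 0" by real_asymp
  moreover have "(\<lambda>K. 3 / (real K + 1)) \<longlonglongrightarrow> 0" by real_asymp
  ultimately have b: "b \<longlonglongrightarrow> 0 + 0 / (x / 2) ^ Suc n"
    unfolding b_def using x0 by (intro tendsto_add tendsto_divide tendsto_const) auto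
  \<comment> \<open>The bound on the right edge is established for even \<open>K\<close>, so the
    limit is taken along \<open>K = 2 * M\<close>.\<close>
  have even: "filterlim (\<lambda>M::nat. 2 * M) sequentially sequentially"
    by (rule filterlim_subseq) (auto simp: strict_mono_def)
  have "\<forall>\<^sub>F K in sequentially. 3 \<le> K \<and> 4 * x \<le> real K + 1 \<and> 2 * exp (\<alpha> + 1) \<le> real K + 1 \<and> 2 \<le> (real K + 1) * x"
    using x0 by (intro eventually_conj eventually_ge_at_top; real_asymp)
  from eventually_compose_filterlim[OF this even]
  have "\<forall>\<^sub>F M in sequentially. \<delta> - 2 * b (2 * M) \<le> s * Re ((deriv ^^ n) (Q (2 * M)) (complex_of_real x) / fact n)"
  proof (rule eventually_mono)
    fix M assume "3 \<le> 2 * M \<and> 4 * x \<le> real (2 * M) + 1 \<and> 2 * exp (\<alpha> + 1) \<le> real (2 * M) + 1 \<and> 2 \<le> (real (2 * M) + 1) * x"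
    then show "\<delta> - 2 * b (2 * M) \<le> s * Re ((deriv ^^ n) (Q (2 * M)) (complex_of_real x) / fact n)"
      unfolding \<delta>_def b_def s_def Q_def
      by (intro deriv_euler_quotient_lower_bound \<alpha>(1) x assms(3)) (elim conjE; assumption | simp)+
  qed
  moreover have "(\<lambda>M. \<delta> - 2 * b (2 * M)) \<longlonglongrightarrow> \<delta> - 2 * 0"
    using filterlim_compose[OF b even] by (intro tendsto_diff tendsto_mult tendsto_const) simp
  moreover have "(\<lambda>M. s * Re ((deriv ^^ n) (Q (2 * M)) (complex_of_real x) / fact n))
      \<longlonglongrightarrow> s * Re ((deriv ^^ n) G (complex_of_real x) / fact n)"
    using filterlim_compose[OF tendsto_deriv_euler_quotient[OF x, of n] even]
    unfolding Q_def G_def by (intro tendsto_mult tendsto_const tendsto_Re tendsto_divide) auto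
  \<comment> \<open>\<open>b\<close> tends to 0 while \<open>\<delta>\<close> stays fixed, so a
    positive lower bound, and not merely nonnegativity, reaches the limit.\<close>
  ultimately have "\<delta> \<le> s * Re ((deriv ^^ n) G (complex_of_real x) / fact n)"
    using tendsto_le[OF sequentially_bot] by force
  also have "Re ((deriv ^^ n) G (complex_of_real x) / fact n) = Re ((deriv ^^ n) G (complex_of_real x)) / fact n"
    using Re_divide_of_real[of _ "fact n"] by simp
  finally have "0 < s * Re ((deriv ^^ n) G (complex_of_real x)) / fact n" using \<delta> by simp
  hence "0 < s * Re ((deriv ^^ n) G (complex_of_real x))" by (simp add: zero_less_divide_iff)
  then show ?thesis unfolding deriv_eq s_def .
qed

end
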